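(* Let $Z\subset\mathbb{R}^d$ be a centrally symmetric convex body centered at the origin and let $m\ge 1$. Then $Z$ is an $m$-operanoid if and only if there exists a $d$-tuple of random matrices $A_1,\dots,A_d$ taking values in $\mathbb{H}^m$ with $\mathbb{E}\big[(\sum_{i=1}^d\|A_i\|_2^2)^{1/2}\big]<\infty$ such that \[h_Z(u)=\mathbb{E}\Big[\Big\|\sum_{i=1}^d u_iA_i\Big\|_1\Big]\quad\text{for all }u\in\mathbb{S}^{d-1}.\]
   Context: $\mathbb{H}^m$ denotes the real Euclidean space of complex Hermitian $m\times m$ matrices with inner product $\langle A,B\rangle=\mathrm{Re}\,\mathrm{tr}(AB)$; $\|A\|_2$ is the Frobenius norm and $\|A\|_1$ the trace (nuclear) norm, i.e. the sum of the absolute values of the eigenvalues of $A$. A convex body is a nonempty compact convex set. The support function of a convex body $K\subset\mathbb{R}^d$ is $h_K(u)=\max_{x\in K}\langle u,x\rangle$; the Hausdorff distance is $d_H(K,L)=\max_{u\in\mathbb{S}^{d-1}}|h_K(u)-h_L(u)|$. A convex body $K$ is centrally symmetric if $K-c=-(K-c)$ for some $c\in\mathbb{R}^d$. An $m$-operatope in $\mathbb{R}^d$ is a centrally symmetric convex body $Z$ whose support function has the form $h_Z(u)=\langle v,u\rangle+\sum_{j=1}^N\|\sum_{i=1}^d u_iA_i^{(j)}\|_1$ for some $N\ge1$, $v\in\mathbb{R}^d$ and matrices $A_i^{(j)}\in\mathbb{H}^m$ (equivalently, a finite Minkowski sum of affine images of the operator norm ball $B_\infty(\mathbb{H}^m)=\{A\in\mathbb{H}^m:\|A\|_{op}\le1\}$).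 An $m$-operanoid in $\mathbb{R}^d$ is a centrally symmetric convex body that is a limit, in the Hausdorff metric, of $m$-operatopes in $\mathbb{R}^d$. *)

theory Defs
  imports "HOL-Probability.Probability" "Jordan_Normal_Form.Char_Poly"
begin

definition herm_mat :: "nat \<Rightarrow> complex mat \<Rightarrow> bool" where
  "herm_mat m A \<longleftrightarrow> A \<in> carrier_mat m m \<and> (\<forall>j<m. \<forall>k<m. A $$ (k, j) = cnj (A $$ (j, k)))"

definition frob_norm :: "nat \<Rightarrow> complex mat \<Rightarrow> real" where
  "frob_norm m A = sqrt (\<Sum>j<m. \<Sum>k<m. (cmod (A $$ (j, k)))\<^sup>2)"

definition trace_norm :: "complex mat \<Rightarrow> real" where
  "trace_norm A = sum_mset (image_mset cmod (proots (char_poly A)))"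

definition lincomb_mat :: "nat \<Rightarrow> real^'d \<Rightarrow> ('d \<Rightarrow> complex mat) \<Rightarrow> complex mat" where
  "lincomb_mat m u A = mat m m (\<lambda>(j, k). \<Sum>i\<in>UNIV. complex_of_real (u $ i) * (A i $$ (j, k)))"

definition supp_fun :: "(real^'d) set \<Rightarrow> real^'d \<Rightarrow> real" where
  "supp_fun K u = (SUP x\<in>K. inner u x)"

definition hausdorff_dist :: "(real^'d) set \<Rightarrow> (real^'d) set \<Rightarrow> real" where
  "hausdorff_dist K L = (SUP u\<in>sphere 0 1. \<bar>supp_fun K u - supp_fun L u\<bar>)"

definition convex_body :: "(real^'d) set \<Rightarrow> bool" where
  "convex_body K \<longleftrightarrow> K \<noteq> {} \<and> compact K \<and> convex K"

definition centrally_symmetric :: "(real^'d) set \<Rightarrow> bool" where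
  "centrally_symmetric K \<longleftrightarrow> (\<exists>c. (\<lambda>x. x - c) ` K = (\<lambda>x. - (x - c)) ` K)"

definition operatope :: "nat \<Rightarrow> (real^'d) set \<Rightarrow> bool" where
  "operatope m Z \<longleftrightarrow> convex_body Z \<and> centrally_symmetric Z \<and>
     (\<exists>N::nat. \<exists>v::real^'d. \<exists>A :: nat \<Rightarrow> 'd \<Rightarrow> complex mat.
        N \<ge> 1 \<and> (\<forall>j<N. \<forall>i. herm_mat m (A j i)) \<and>
        (\<forall>u. supp_fun Z u = inner v u + (\<Sum>j<N. trace_norm (lincomb_mat m u (A j)))))"

definition operanoid :: "nat \<Rightarrow> (real^'d) set \<Rightarrow> bool" where
  "operanoid m Z \<longleftrightarrow> convex_body Z \<and> centrally_symmetric Z \<and>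
     (\<exists>Zs :: nat \<Rightarrow> (real^'d) set. (\<forall>k. operatope m (Zs k)) \<and>
        (\<lambda>k. hausdorff_dist (Zs k) Z) \<longlonglongrightarrow> 0)"

definition random_rep :: "nat \<Rightarrow> (real^'d) set \<Rightarrow> 'w measure \<Rightarrow> ('w \<Rightarrow> 'd \<Rightarrow> complex mat) \<Rightarrow> bool" where
  "random_rep m Z M A \<longleftrightarrow> prob_space M \<and>
     (\<forall>\<omega>\<in>space M. \<forall>i. herm_mat m (A \<omega> i)) \<and>
     (\<forall>i. \<forall>j<m. \<forall>k<m. (\<lambda>\<omega>. A \<omega> i $$ (j, k)) \<in> borel_measurable M) \<and>
     integrable M (\<lambda>\<omega>. sqrt (\<Sum>i\<in>UNIV. (frob_norm m (A \<omega> i))\<^sup>2)) \<and>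
     (\<forall>u\<in>sphere 0 1. supp_fun Z u = (\<integral>\<omega>. trace_norm (lincomb_mat m u (A \<omega>)) \<partial>M))"

end

theory Submission
  imports Defs "Jordan_Normal_Form.Schur_Decomposition"
begin

text \<open>Everything about the trace norm comes from the pinching inequality: by the spectral theorem the
  diagonal of a Hermitian matrix in any orthonormal basis has \<open>l\<^sup>1\<close>-norm at most the trace norm, with
  equality in an eigenbasis.

  If \<open>Z\<close> has a random representation, approximate the entries by simple functions. The
  expectation of a simple function is a finite sum of trace norms, hence the support function of an
  operatope, and the error is bounded uniformly on the sphere by an \<open>L\<^sup>1\<close>-distance.

  Conversely, symmetry of \<open>Z\<close> allows one to drop the linear parts of the approximating operatopes. Their
  finite sums become expectations with respect to discrete probability measures on matrix tuples of
  bounded size, the total mass being controlled by the values at the coordinate vectors. To extract a limit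
  with the Helly selection theorem on the real line, these measures are
  pulled back to \<open>[0, 1]\<close> along a space-filling curve in the space of matrix tuples; the weak limit
  on \<open>[0, 1]\<close> together with the curve is the random representation.\<close>

no_notation vec_nth (infixl "$" 90)

section \<open>The spectral theorem for Hermitian matrices\<close>

definition adj :: "complex mat \<Rightarrow> complex mat" where
  "adj A = Matrix.mat (dim_col A) (dim_row A) (\<lambda>(i, j). cnj (A $$ (j, i)))"

lemma adj_carrier [intro]: "A \<in> carrier_mat n p \<Longrightarrow> adj A \<in> carrier_mat p n"
  by (auto simp: adj_def)

lemma index_adj [simp]: "A \<in> carrier_mat n p \<Longrightarrow> i < p \<Longrightarrow> j < n \<Longrightarrow> adj A $$ (i, j) = cnj (A $$ (j, i))"
  by (auto simp: adj_def)

lemma index_mult_carrier: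
  assumes "A \<in> carrier_mat n p" "B \<in> carrier_mat p q" "i < n" "j < q"
  shows "(A * B) $$ (i, j) = (\<Sum>k<p. A $$ (i, k) * B $$ (k, j))"
  using assms by (auto simp: scalar_prod_def atLeast0LessThan intro!: sum.cong)

lemma adj_adj: "adj (adj A) = A"
  by (rule eq_matI) (auto simp: adj_def)

lemma adj_mult:
  assumes "A \<in> carrier_mat n p" "B \<in> carrier_mat p q"
  shows "adj (A * B) = adj B * adj A"
proof (rule eq_matI)
  fix i j assume "i < dim_row (adj B * adj A)" "j < dim_col (adj B * adj A)"
  then have ij: "i < q" "j < n" using assms by (auto simp: adj_def)
  have "adj (A * B) $$ (i, j) = cnj ((A * B) $$ (j, i))"
    using assms ij by (auto simp: adj_def)
  also have "\<dots> = (\<Sum>k<p. cnj (A $$ (j, k)) * cnj (B $$ (k, i)))"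
    using assms ij by (subst index_mult_carrier[of _ n p _ q]) auto
  also have "\<dots> = (\<Sum>k<p. adj B $$ (i, k) * adj A $$ (k, j))"
    using assms ij by (intro sum.cong) (auto simp: mult.commute)
  also have "\<dots> = (adj B * adj A) $$ (i, j)"
    using index_mult_carrier[OF adj_carrier[OF assms(2)] adj_carrier[OF assms(1)] ij] by simp
  finally show "adj (A * B) $$ (i, j) = (adj B * adj A) $$ (i, j)" .
qed (use assms in \<open>auto simp: adj_def\<close>)

lemma herm_mat_carrier: "herm_mat m A \<Longrightarrow> A \<in> carrier_mat m m"
  by (simp add: herm_mat_def)

lemma herm_mat_index: "herm_mat m A \<Longrightarrow> j < m \<Longrightarrow> k < m \<Longrightarrow> A $$ (j, k) = cnj (A $$ (k, j))"
  unfolding herm_mat_def by blast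

lemma herm_mat_iff_adj: "herm_mat m A \<longleftrightarrow> A \<in> carrier_mat m m \<and> adj A = A"
proof
  assume h: "herm_mat m A"
  then have A: "A \<in> carrier_mat m m" by (simp add: herm_mat_def)
  have "adj A = A"
  proof (rule eq_matI)
    fix i j assume "i < dim_row A" "j < dim_col A"
    with A have ij: "i < m" "j < m" by auto
    then have "A $$ (i, j) = cnj (A $$ (j, i))" using h unfolding herm_mat_def by blast
    then show "adj A $$ (i, j) = A $$ (i, j)" using index_adj[OF A ij] by simp
  qed (use A in \<open>simp_all add: adj_def\<close>)
  with A show "A \<in> carrier_mat m m \<and> adj A = A" ..
next
  assume h: "A \<in> carrier_mat m m \<and> adj A = A"
  have "A $$ (k, j) = cnj (A $$ (j, k))" if "j < m" "k < m" for j k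
    using h that index_adj[of A m m k j] by auto
  then show "herm_mat m A" using h unfolding herm_mat_def by blast
qed

section \<open>Unitary matrices\<close>

definition unitary_mat :: "nat \<Rightarrow> complex mat \<Rightarrow> bool" where
  "unitary_mat m U \<longleftrightarrow> U \<in> carrier_mat m m \<and> adj U * U = 1\<^sub>m m \<and> U * adj U = 1\<^sub>m m"

text \<open>A left inverse of a square matrix is also a right inverse.\<close>

lemma unitary_matI:
  assumes U: "U \<in> carrier_mat m m" and "adj U * U = 1\<^sub>m m"
  shows "unitary_mat m U"
  using assms mat_mult_left_right_inverse[of "adj U" m U] adj_carrier[OF U] by (auto simp: unitary_mat_def)

lemma unitary_mat_mult:
  assumes "unitary_mat m U" "unitary_mat m V"
  shows "unitary_mat m (U * V)"
proof (rule unitary_matI)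
  have c: "U \<in> carrier_mat m m" "V \<in> carrier_mat m m" "adj U \<in> carrier_mat m m" "adj V \<in> carrier_mat m m"
    using assms by (auto simp: unitary_mat_def)
  then show "U * V \<in> carrier_mat m m" by auto
  have "adj (U * V) * (U * V) = adj V * (adj U * U) * V"
    using c by (simp add: adj_mult[of _ m m _ m] assoc_mult_mat[of _ m m _ m _ m])
  also have "\<dots> = 1\<^sub>m m" using assms c by (simp add: unitary_mat_def)
  finally show "adj (U * V) * (U * V) = 1\<^sub>m m" .
qed

lemma unitary_mat_adj: "unitary_mat m U \<Longrightarrow> unitary_mat m (adj U)"
  by (auto simp: unitary_mat_def adj_adj)

text \<open>Extend \<open>v\<close> to a basis, orthogonalise with \<open>v\<close> in first place,
  where Gram-Schmidt leaves it unchanged, and normalise. The scalar \<open>c\<close> is the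
  normalising factor; deflation depends only on the line through \<open>v\<close>.\<close>

lemma unitary_mat_with_first_column:
  assumes v: "v \<in> carrier_vec n" "v \<noteq> 0\<^sub>v n"
  shows "\<exists>W c. unitary_mat n W \<and> c \<noteq> 0 \<and> (\<forall>i<n. W $$ (i, 0) = c * v $ i)"
proof -
  interpret cof_vec_space n "TYPE(complex)" .
  define b where "b = basis_completion v"
  define ws where "ws = gram_schmidt n b"
  from basis_completion[OF v, folded b_def]
  have dist_b: "distinct b" 
    and indep: "\<not> lin_dep (set b)" and b: "set b \<subseteq> carrier_vec n" and hdb: "hd b = v" 
    and len_b: "length b = n" by auto
  have n: "n \<noteq> 0" using v by (auto intro!: eq_vecI)
  from hdb len_b n obtain vs where bv: "b = v # vs" by (cases b, auto)
  from gram_schmidt_result[OF b dist_b indep refl, folded ws_def]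
  have ws: "set ws \<subseteq> carrier_vec n" "corthogonal ws" "length ws = n" 
    by (auto simp: len_b)
  from gram_schmidt_hd[OF v(1), of vs, folded bv] have hdws: "hd ws = v" unfolding ws_def .
  then have ws0: "ws ! 0 = v" using n ws(3) by (cases ws) auto
  have wsc: "dim_vec (ws ! i) = n" if "i < n" for i
    using ws that by (metis carrier_vecD nth_mem subsetD)
  define s where "s j = (\<Sum>i<n. (cmod (ws ! j $ i))\<^sup>2)" for j
  have ip: "ws ! k \<bullet>c ws ! j = (\<Sum>i<n. cnj (ws ! j $ i) * ws ! k $ i)" if "j < n" "k < n" for j k
    using wsc[OF that(1)] wsc[OF that(2)]
    by (auto simp: scalar_prod_def atLeast0LessThan conjugate_vec_def intro!: sum.cong)
  have sj: "ws ! j \<bullet>c ws ! j = complex_of_real (s j)" if "j < n" for j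
    using that by (simp add: ip s_def complex_norm_square mult.commute del: of_real_power)
  have s0: "s j > 0" if "j < n" for j
  proof -
    have "s j \<ge> 0" by (auto simp: s_def intro!: sum_nonneg)
    moreover have "s j \<noteq> 0" using corthogonalD[OF ws(2), of j j] that sj[OF that] ws(3) by auto
    ultimately show ?thesis by simp
  qed
  define W where "W = Matrix.mat n n (\<lambda>(i, j). ws ! j $ i / complex_of_real (sqrt (s j)))"
  have W: "W \<in> carrier_mat n n" by (simp add: W_def)
  have "adj W * W = 1\<^sub>m n"
  proof (rule eq_matI)
    fix j k assume "j < dim_row (1\<^sub>m n)" "k < dim_col (1\<^sub>m n)"
    then have jk: "j < n" "k < n" by auto
    have "(adj W * W) $$ (j, k) = (\<Sum>i<n. cnj (W $$ (i, j)) * W $$ (i, k))"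
      using W adj_carrier[OF W] jk by (subst index_mult_carrier[of _ n n _ n]) auto
    also have "\<dots> = (\<Sum>i<n. cnj (ws ! j $ i) * ws ! k $ i) / complex_of_real (sqrt (s j) * sqrt (s k))"
      using jk by (simp add: W_def sum_divide_distrib)
    also have "\<dots> = (ws ! k \<bullet>c ws ! j) / complex_of_real (sqrt (s j) * sqrt (s k))"
      using ip jk by simp
    also have "\<dots> = (if j = k then 1 else 0)"
    proof (cases "j = k")
      case True
      have "sqrt (s k) * sqrt (s k) = s k" using s0[OF jk(2)] by simp
      then show ?thesis using True sj[OF jk(2)] s0[OF jk(2)] by (simp del: of_real_mult real_sqrt_mult_self)
    next
      case False
      then show ?thesis using corthogonalD[OF ws(2), of k j] jk ws(3) by auto
    qed
    finally show "(adj W * W) $$ (j, k) = 1\<^sub>m n $$ (j, k)" using jk by simp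
  qed (use W in \<open>auto simp: adj_def\<close>)
  with W have "unitary_mat n W" by (rule unitary_matI)
  moreover have "W $$ (i, 0) = (1 / complex_of_real (sqrt (s 0))) * v $ i" if "i < n" for i
    using that n by (simp add: W_def ws0)
  moreover have "1 / complex_of_real (sqrt (s 0)) \<noteq> 0" using s0[of 0] n by simp
  ultimately show ?thesis
    by (intro exI[of _ W] exI[of _ "1 / complex_of_real (sqrt (s 0))"]) auto
qed

section \<open>Diagonalisation by deflation\<close>

lemma adj_four_block_diag:
  assumes "A \<in> carrier_mat n n" "B \<in> carrier_mat p p"
  shows "adj (four_block_mat A (0\<^sub>m n p) (0\<^sub>m p n) B) = four_block_mat (adj A) (0\<^sub>m n p) (0\<^sub>m p n) (adj B)"
proof (rule eq_matI)
  fix i j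
  assume "i < dim_row (four_block_mat (adj A) (0\<^sub>m n p) (0\<^sub>m p n) (adj B))"
    and "j < dim_col (four_block_mat (adj A) (0\<^sub>m n p) (0\<^sub>m p n) (adj B))"
  then have ij: "i < n + p" "j < n + p" using assms by (auto simp: adj_def)
  show "adj (four_block_mat A (0\<^sub>m n p) (0\<^sub>m p n) B) $$ (i, j) = four_block_mat (adj A) (0\<^sub>m n p) (0\<^sub>m p n) (adj B) $$ (i, j)"
    using assms ij by (cases "i < n"; cases "j < n") (simp_all add: adj_def)
qed (use assms in \<open>simp_all add: adj_def\<close>)

lemma mult_four_block_diag:
  fixes A :: "'a :: comm_ring_1 mat"
  assumes "A \<in> carrier_mat n n" "B \<in> carrier_mat p p" "A' \<in> carrier_mat n n" "B' \<in> carrier_mat p p"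
  shows "four_block_mat A (0\<^sub>m n p) (0\<^sub>m p n) B * four_block_mat A' (0\<^sub>m n p) (0\<^sub>m p n) B'
    = four_block_mat (A * A') (0\<^sub>m n p) (0\<^sub>m p n) (B * B')"
proof -
  have z: "0\<^sub>m n p \<in> carrier_mat n p" for n p by auto
  show ?thesis
    unfolding mult_four_block_mat[OF assms(1) z z assms(2,3) z z assms(4)]
    using assms by simp
qed

text \<open>Deflation by induction on the dimension: with an eigenvector as first basis vector,
  Hermitian symmetry clears the first row along with the first column, and the induction hypothesis
  diagonalises the remaining Hermitian block.\<close>

lemma spectral_theorem:
  assumes "herm_mat m A"
  shows "\<exists>U. unitary_mat m U \<and> diagonal_mat (adj U * A * U)"
  using assms
proof (induction m arbitrary: A)
  case 0
  then have "A \<in> carrier_mat 0 0" by (simp add: herm_mat_def)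
  moreover have "unitary_mat 0 (1\<^sub>m 0)"
    by (rule unitary_matI) (auto simp: adj_def)
  ultimately show ?case by (intro exI[of _ "1\<^sub>m 0"]) (auto simp: diagonal_mat_def adj_def)
next
  case (Suc m)
  let ?n = "Suc m"
  have A: "A \<in> carrier_mat ?n ?n" and adjA: "adj A = A" using Suc.prems by (auto simp: herm_mat_iff_adj)
  have "degree (char_poly A) = ?n" using degree_monic_char_poly[OF A] by simp
  then obtain e where "poly (char_poly A) e = 0"
    using fundamental_theorem_of_algebra[of "char_poly A"] by (metis constant_degree nat.distinct(1))
  then have "eigenvalue A e" using eigenvalue_root_char_poly[OF A] by simp
  then obtain v where v: "v \<in> carrier_vec ?n" "v \<noteq> 0\<^sub>v ?n" "A *\<^sub>v v = e \<cdot>\<^sub>v v"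
    using A by (auto simp: eigenvalue_def eigenvector_def)
  obtain W c where W: "unitary_mat ?n W" and c: "c \<noteq> 0" "\<And>i. i < ?n \<Longrightarrow> W $$ (i, 0) = c * v $ i"
    using unitary_mat_with_first_column[OF v(1,2)] by auto
  have Wc: "W \<in> carrier_mat ?n ?n" "adj W \<in> carrier_mat ?n ?n" using W by (auto simp: unitary_mat_def)
  define B where "B = adj W * A * W"
  have B: "B \<in> carrier_mat ?n ?n" using Wc A by (auto simp: B_def)
  have adjB: "adj B = B"
    using Wc A adjA
    by (simp add: B_def adj_mult[of _ ?n ?n _ ?n] adj_adj assoc_mult_mat[of _ ?n ?n _ ?n _ ?n])
  have AW: "(A * W) $$ (i, 0) = e * W $$ (i, 0)" if i: "i < ?n" for i
  proof -
    have "(A * W) $$ (i, 0) = (\<Sum>k<?n. A $$ (i, k) * W $$ (k, 0))"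
      using Wc A i by (subst index_mult_carrier[of _ ?n ?n _ ?n]) auto
    also have "\<dots> = c * (\<Sum>k<?n. A $$ (i, k) * v $ k)"
      by (simp add: c(2) sum_distrib_left ac_simps del: sum.lessThan_Suc)
    also have "(\<Sum>k<?n. A $$ (i, k) * v $ k) = (A *\<^sub>v v) $ i"
      using A v(1) i by (auto simp: mult_mat_vec_def scalar_prod_def atLeast0LessThan intro!: sum.cong)
    also have "\<dots> = e * v $ i" using v i by auto
    finally show ?thesis using c(2)[OF i] by simp
  qed
  have B0: "B $$ (i, 0) = (if i = 0 then e else 0)" if i: "i < ?n" for i
  proof -
    have "B = adj W * (A * W)" using A Wc by (simp add: B_def assoc_mult_mat[of _ ?n ?n _ ?n _ ?n])
    then have "B $$ (i, 0) = (\<Sum>k<?n. adj W $$ (i, k) * (A * W) $$ (k, 0))"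
      using index_mult_carrier[OF Wc(2) mult_carrier_mat[OF A Wc(1)] i, of 0] by simp
    also have "\<dots> = e * (\<Sum>k<?n. adj W $$ (i, k) * W $$ (k, 0))"
      by (simp add: AW sum_distrib_left ac_simps del: sum.lessThan_Suc)
    also have "(\<Sum>k<?n. adj W $$ (i, k) * W $$ (k, 0)) = (adj W * W) $$ (i, 0)"
      using index_mult_carrier[OF Wc(2,1) i, of 0] by simp
    finally show ?thesis using W i by (auto simp: unitary_mat_def)
  qed
  \<comment> \<open>Symmetry carries the zeros of the first column over to the first row.\<close>
  have B0': "B $$ (0, i) = (if i = 0 then cnj e else 0)" if i: "i < ?n" for i
    using index_adj[OF B, of 0 i] adjB B0[OF i] i by auto
  define C where "C = Matrix.mat m m (\<lambda>(i, j). B $$ (Suc i, Suc j))"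
  define E where "E = Matrix.mat 1 1 (\<lambda>_. e)"
  have C: "C \<in> carrier_mat m m" and E: "E \<in> carrier_mat 1 1" by (auto simp: C_def E_def)
  have Bblock: "B = four_block_mat E (0\<^sub>m 1 m) (0\<^sub>m m 1) C"
  proof (rule eq_matI)
    fix i j
    assume "i < dim_row (four_block_mat E (0\<^sub>m 1 m) (0\<^sub>m m 1) C)"
      and "j < dim_col (four_block_mat E (0\<^sub>m 1 m) (0\<^sub>m m 1) C)"
    then have "i < ?n" "j < ?n" using E C by simp_all
    then show "B $$ (i, j) = four_block_mat E (0\<^sub>m 1 m) (0\<^sub>m m 1) C $$ (i, j)"
      using B0 B0' E C by (cases i; cases j) (simp_all add: E_def C_def)
  qed (use B E C in simp_all)
  have "herm_mat m C"
    unfolding herm_mat_def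
  proof (intro conjI allI impI)
    fix j k assume "j < m" "k < m"
    then show "C $$ (k, j) = cnj (C $$ (j, k))"
      using index_adj[OF B, of "Suc k" "Suc j"] adjB by (simp add: C_def)
  qed (rule C)
  then obtain U where U: "unitary_mat m U" and D0: "diagonal_mat (adj U * C * U)"
    using Suc.IH by blast
  define F where "F = adj U * C * U"
  have D: "diagonal_mat F" using D0 by (simp only: F_def)
  have Uc: "U \<in> carrier_mat m m" "adj U \<in> carrier_mat m m" using U by (auto simp: unitary_mat_def)
  have F: "F \<in> carrier_mat m m" using Uc C by (simp add: F_def)
  \<comment> \<open>The first basis vector stays fixed while \<open>U\<close> acts on the other
    coordinates.\<close>
  define V where "V = four_block_mat (1\<^sub>m 1) (0\<^sub>m 1 m) (0\<^sub>m m 1) U"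
  have adj1: "adj (1\<^sub>m 1) = 1\<^sub>m 1" by (rule eq_matI) (auto simp: adj_def)
  have adjV: "adj V = four_block_mat (1\<^sub>m 1) (0\<^sub>m 1 m) (0\<^sub>m m 1) (adj U)"
    unfolding V_def using adj_four_block_diag[OF one_carrier_mat Uc(1), of 1] by (simp only: adj1)
  have Vc: "V \<in> carrier_mat ?n ?n" using Uc by (auto simp: V_def)
  have V: "unitary_mat ?n V"
  proof (rule unitary_matI)
    have "adj V * V = four_block_mat (1\<^sub>m 1) (0\<^sub>m 1 m) (0\<^sub>m m 1) (adj U * U)"
      unfolding adjV using Uc by (simp add: V_def mult_four_block_diag)
    also have "\<dots> = 1\<^sub>m ?n" using U by (simp add: unitary_mat_def four_block_one_mat)
    finally show "adj V * V = 1\<^sub>m ?n" .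
  qed (rule Vc)
  have "adj (W * V) * A * (W * V) = adj V * B * V"
    using Wc A Vc adj_carrier[OF Vc]
    by (simp add: B_def adj_mult[of _ ?n ?n _ ?n] assoc_mult_mat[of _ ?n ?n _ ?n _ ?n])
  also have "\<dots> = four_block_mat E (0\<^sub>m 1 m) (0\<^sub>m m 1) F"
    unfolding adjV Bblock F_def using Uc C E
    by (simp add: V_def mult_four_block_diag)
  finally have eq: "adj (W * V) * A * (W * V) = four_block_mat E (0\<^sub>m 1 m) (0\<^sub>m m 1) F" .
  have "diagonal_mat (four_block_mat E (0\<^sub>m 1 m) (0\<^sub>m m 1) F)"
    unfolding diagonal_mat_def
  proof (intro allI impI)
    fix i j
    assume ij: "i < dim_row (four_block_mat E (0\<^sub>m 1 m) (0\<^sub>m m 1) F)"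
      "j < dim_col (four_block_mat E (0\<^sub>m 1 m) (0\<^sub>m m 1) F)" "i \<noteq> j"
    with E F have ij': "i < ?n" "j < ?n" by simp_all
    show "four_block_mat E (0\<^sub>m 1 m) (0\<^sub>m m 1) F $$ (i, j) = 0"
    proof (cases "i = 0 \<or> j = 0")
      case True
      then show ?thesis using E F ij(3) ij' by (auto simp: less_Suc_eq_0_disj)
    next
      case False
      then obtain i' j' where "i = Suc i'" "j = Suc j'" by (metis not0_implies_Suc)
      moreover have "F $$ (i', j') = 0"
        using D F ij(3) ij' calculation by (simp add: diagonal_mat_def)
      ultimately show ?thesis using E F ij' by simp
    qed
  qed
  then have "diagonal_mat (adj (W * V) * A * (W * V))" by (simp only: eq)
  with unitary_mat_mult[OF W V] show ?case by (intro exI[of _ "W * V"] conjI)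
qed


section \<open>The trace norm\<close>

text \<open>The entry is the sesquilinear form of \<open>A\<close> at columns \<open>l\<close> and
  \<open>k\<close> of \<open>V\<close>. Written out, it shows linearity in \<open>A\<close>, on
  which the triangle inequality and homogeneity rest.\<close>

lemma index_conj_unitary:
  assumes "A \<in> carrier_mat m m" "V \<in> carrier_mat m m" "l < m" "k < m"
  shows "(adj V * A * V) $$ (l, k) = (\<Sum>a<m. \<Sum>b<m. cnj (V $$ (a, l)) * A $$ (a, b) * V $$ (b, k))"
proof -
  have "(adj V * A * V) $$ (l, k) = (\<Sum>b<m. (adj V * A) $$ (l, b) * V $$ (b, k))"
    using index_mult_carrier[OF mult_carrier_mat[OF adj_carrier[OF assms(2)] assms(1)] assms(2,3,4)] .
  also have "\<dots> = (\<Sum>b<m. (\<Sum>a<m. cnj (V $$ (a, l)) * A $$ (a, b)) * V $$ (b, k))"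
    using index_mult_carrier[OF adj_carrier[OF assms(2)] assms(1,3)] index_adj[OF assms(2,3)]
    by (intro sum.cong) auto
  also have "\<dots> = (\<Sum>a<m. \<Sum>b<m. cnj (V $$ (a, l)) * A $$ (a, b) * V $$ (b, k))"
    by (subst sum.swap) (simp add: sum_distrib_right)
  finally show ?thesis .
qed

lemma unitary_mat_row_norm:
  assumes "unitary_mat m U" "k < m"
  shows "(\<Sum>l<m. (cmod (U $$ (k, l)))\<^sup>2) = 1"
proof -
  have U: "U \<in> carrier_mat m m" and "U * adj U = 1\<^sub>m m" using assms by (auto simp: unitary_mat_def)
  then have "1 = (U * adj U) $$ (k, k)" using assms by simp
  also have "\<dots> = (\<Sum>l<m. U $$ (k, l) * cnj (U $$ (k, l)))"
    using index_mult_carrier[OF U adj_carrier[OF U] assms(2,2)] index_adj[OF U _ assms(2)]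
    by simp
  also have "\<dots> = complex_of_real (\<Sum>l<m. (cmod (U $$ (k, l)))\<^sup>2)"
    by (simp add: complex_norm_square del: of_real_power)
  finally show ?thesis by (metis of_real_eq_1_iff)
qed

text \<open>The arithmetic-geometric mean inequality in each term reduces the sum to the norms of
  two unit rows.\<close>

lemma unitary_mat_rows_product_le:
  assumes "unitary_mat m U" "j < m" "k < m"
  shows "(\<Sum>l<m. cmod (U $$ (j, l)) * cmod (U $$ (k, l))) \<le> 1"
proof -
  have "cmod (U $$ (j, l)) * cmod (U $$ (k, l)) \<le> ((cmod (U $$ (j, l)))\<^sup>2 + (cmod (U $$ (k, l)))\<^sup>2) / 2" for l
    using sum_squares_bound[of "cmod (U $$ (j, l))" "cmod (U $$ (k, l))"] by simp
  then have "(\<Sum>l<m. cmod (U $$ (j, l)) * cmod (U $$ (k, l)))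
      \<le> (\<Sum>l<m. ((cmod (U $$ (j, l)))\<^sup>2 + (cmod (U $$ (k, l)))\<^sup>2) / 2)"
    by (rule sum_mono)
  also have "\<dots> = 1"
    using unitary_mat_row_norm[OF assms(1,2)] unitary_mat_row_norm[OF assms(1,3)]
    by (simp add: sum_divide_distrib[symmetric] sum.distrib)
  finally show ?thesis .
qed

lemma unitary_conj_cancel:
  assumes "unitary_mat m U" "A \<in> carrier_mat m m"
  shows "U * (adj U * A * U) * adj U = A"
proof -
  have U: "U \<in> carrier_mat m m" "adj U \<in> carrier_mat m m" "U * adj U = 1\<^sub>m m"
    using assms by (auto simp: unitary_mat_def)
  have "U * (adj U * A * U) * adj U = U * (adj U * (A * (U * adj U)))"
    using U(1,2) assms(2) by (simp add: assoc_mult_mat[of _ m m _ m _ m])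
  also have "A * (U * adj U) = A" using U assms(2) by simp
  also have "U * (adj U * A) = (U * adj U) * A"
    using assoc_mult_mat[OF U(1,2) assms(2)] by simp
  finally show ?thesis using U assms(2) by simp
qed

lemma proots_linear_factors:
  fixes xs :: "'a :: idom list"
  shows "proots (\<Prod>a\<leftarrow>xs. [:- a, 1:]) = mset xs"
proof (induction xs)
  case (Cons a xs)
  have "(\<Prod>a\<leftarrow>xs. [:- a, 1:]) \<noteq> 0" by (auto simp: prod_list_zero_iff)
  with Cons show ?case by (simp add: proots_mult del: mult_pCons_left)
qed simp

text \<open>Similar matrices share their characteristic polynomial, and that of a diagonal matrix
  splits into linear factors whose roots, with multiplicity, are the diagonal entries.\<close>

lemma trace_norm_unitary_diagonal:
  assumes U: "unitary_mat m U" and A: "A \<in> carrier_mat m m"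
    and D: "diagonal_mat (adj U * A * U)"
  shows "trace_norm A = (\<Sum>l<m. cmod ((adj U * A * U) $$ (l, l)))"
proof -
  define B where "B = adj U * A * U"
  have Uc: "U \<in> carrier_mat m m" "adj U \<in> carrier_mat m m" using U by (auto simp: unitary_mat_def)
  have B: "B \<in> carrier_mat m m" using Uc A by (simp add: B_def)
  have "similar_mat_wit A B U (adj U)"
    using U Uc A B unitary_conj_cancel[OF U A]
    by (intro similar_mat_witI[of _ _ m]) (auto simp: B_def unitary_mat_def)
  then have "char_poly A = char_poly B" by (intro char_poly_similar) (auto simp: similar_mat_def)
  also have "\<dots> = (\<Prod>a\<leftarrow>diag_mat B. [:- a, 1:])"
    by (rule char_poly_upper_triangular[OF B]) (use D B in \<open>auto simp: B_def[symmetric] diagonal_mat_def\<close>)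
  finally have "proots (char_poly A) = mset (diag_mat B)"
    by (simp add: proots_linear_factors)
  then have "trace_norm A = sum_list (map cmod (diag_mat B))"
    by (simp add: trace_norm_def flip: mset_map sum_mset_sum_list)
  also have "\<dots> = (\<Sum>l<m. cmod (B $$ (l, l)))"
    using B by (simp add: diag_mat_def o_def interv_sum_list_conv_sum_set_nat atLeast0LessThan)
  finally show ?thesis by (simp add: B_def)
qed

text \<open>The pinching inequality. Each diagonal entry combines the eigenvalues with the squared
  moduli in one column of \<open>W = adj U * V\<close> as weights; summed over the columns, every
  eigenvalue receives total weight one because the rows of \<open>W\<close> are unit
  vectors.\<close>

lemma sum_diagonal_le_trace_norm:
  assumes A: "herm_mat m A" and V: "unitary_mat m V"
  shows "(\<Sum>l<m. cmod ((adj V * A * V) $$ (l, l))) \<le> trace_norm A"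
proof -
  obtain U where U: "unitary_mat m U" and D: "diagonal_mat (adj U * A * U)"
    using spectral_theorem[OF A] by blast
  define B where "B = adj U * A * U"
  define W where "W = adj U * V"
  have W: "unitary_mat m W" unfolding W_def by (intro unitary_mat_mult unitary_mat_adj U V)
  have c: "A \<in> carrier_mat m m" "U \<in> carrier_mat m m" "adj U \<in> carrier_mat m m" "V \<in> carrier_mat m m"
    "adj V \<in> carrier_mat m m" "W \<in> carrier_mat m m" "adj W \<in> carrier_mat m m"
    using A U V W by (auto simp: unitary_mat_def herm_mat_def)
  have B: "B \<in> carrier_mat m m" using c by (simp add: B_def)
  have "A = U * B * adj U" using unitary_conj_cancel[OF U c(1)] by (simp add: B_def)
  then have "adj V * A * V = adj W * B * W"
    using c B by (simp add: W_def adj_mult[of _ m m _ m] adj_adj assoc_mult_mat[of _ m m _ m _ m])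
  then have "(adj V * A * V) $$ (l, l) = (\<Sum>a<m. B $$ (a, a) * complex_of_real ((cmod (W $$ (a, l)))\<^sup>2))"
    if "l < m" for l
  proof -
    have "(adj V * A * V) $$ (l, l) = (\<Sum>a<m. \<Sum>b<m. cnj (W $$ (a, l)) * B $$ (a, b) * W $$ (b, l))"
      using \<open>adj V * A * V = _\<close> index_conj_unitary[OF B c(6) that that] by simp
    also have "\<dots> = (\<Sum>a<m. \<Sum>b<m. if b = a then cnj (W $$ (a, l)) * B $$ (a, a) * W $$ (a, l) else 0)"
      using D B by (intro sum.cong) (auto simp: B_def[symmetric] diagonal_mat_def)
    also have "\<dots> = (\<Sum>a<m. B $$ (a, a) * complex_of_real ((cmod (W $$ (a, l)))\<^sup>2))"
      by (intro sum.cong) (auto simp: complex_norm_square mult_ac simp del: of_real_power)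
    finally show ?thesis .
  qed
  then have "(\<Sum>l<m. cmod ((adj V * A * V) $$ (l, l)))
      \<le> (\<Sum>l<m. \<Sum>a<m. cmod (B $$ (a, a)) * (cmod (W $$ (a, l)))\<^sup>2)"
    by (intro sum_mono) (simp add: order.trans[OF norm_sum] norm_mult norm_power del: index_mult_mat)
  also have "\<dots> = (\<Sum>a<m. cmod (B $$ (a, a)) * (\<Sum>l<m. (cmod (W $$ (a, l)))\<^sup>2))"
    by (subst sum.swap) (simp add: sum_distrib_left)
  also have "\<dots> = (\<Sum>a<m. cmod (B $$ (a, a)))"
    using unitary_mat_row_norm[OF W] by simp
  also have "\<dots> = trace_norm A" using trace_norm_unitary_diagonal[OF U c(1) D] by (simp add: B_def)
  finally show ?thesis .
qed

text \<open>Pinching is an equality in an eigenbasis. The last clause is the spectral decomposition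
  written entrywise, from which single entries are bounded by the trace norm.\<close>

lemma trace_norm_attained:
  assumes A: "herm_mat m A"
  obtains U where "unitary_mat m U" "trace_norm A = (\<Sum>l<m. cmod ((adj U * A * U) $$ (l, l)))"
    "\<forall>j<m. \<forall>k<m.
      A $$ (j, k) = (\<Sum>l<m. U $$ (j, l) * (adj U * A * U) $$ (l, l) * cnj (U $$ (k, l)))"
proof -
  obtain U where U: "unitary_mat m U" and D: "diagonal_mat (adj U * A * U)"
    using spectral_theorem[OF A] by blast
  have Ac: "A \<in> carrier_mat m m" using A by (simp add: herm_mat_def)
  define B where "B = adj U * A * U"
  have c: "U \<in> carrier_mat m m" "adj U \<in> carrier_mat m m" "B \<in> carrier_mat m m"
    using U Ac by (auto simp: unitary_mat_def B_def intro!: mult_carrier_mat)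
  have entry: "A $$ (j, k) = (\<Sum>l<m. U $$ (j, l) * B $$ (l, l) * cnj (U $$ (k, l)))"
    if "j < m" "k < m" for j k
  proof -
    have "A = adj (adj U) * B * adj U"
      using unitary_conj_cancel[OF U Ac] by (simp add: B_def adj_adj)
    then have "A $$ (j, k) = (\<Sum>a<m. \<Sum>b<m. cnj (adj U $$ (a, j)) * B $$ (a, b) * adj U $$ (b, k))"
      using index_conj_unitary[OF c(3,2) that] by simp
    also have "\<dots> = (\<Sum>a<m. \<Sum>b<m. if b = a then U $$ (j, a) * B $$ (a, a) * cnj (U $$ (k, a)) else 0)"
      using D c that by (intro sum.cong) (auto simp: B_def[symmetric] diagonal_mat_def)
    finally show ?thesis by simp
  qed
  show thesis using that[OF U trace_norm_unitary_diagonal[OF U Ac D]] entry unfolding B_def by blast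
qed

section \<open>Norm properties and comparison with the entries\<close>

lemma trace_norm_nonneg: "trace_norm A \<ge> 0"
proof -
  have "\<Sum>\<^sub># (image_mset cmod X) \<ge> 0" for X by (induction X) auto
  then show ?thesis by (simp add: trace_norm_def)
qed

text \<open>In an eigenbasis of \<open>C\<close> the diagonals add up, and pinching bounds the
  diagonals of \<open>A\<close> and \<open>B\<close> there. The sum is stated entrywise so that it
  applies directly to matrices built by \<open>mat\<close>.\<close>

lemma trace_norm_triangle:
  assumes "herm_mat m A" "herm_mat m B" "herm_mat m C"
    and eq: "\<And>j k. j < m \<Longrightarrow> k < m \<Longrightarrow> C $$ (j, k) = A $$ (j, k) + B $$ (j, k)"
  shows "trace_norm C \<le> trace_norm A + trace_norm B"
proof -
  obtain U where U: "unitary_mat m U" "trace_norm C = (\<Sum>l<m. cmod ((adj U * C * U) $$ (l, l)))"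
    by (rule trace_norm_attained[OF assms(3)]) (rule that)
  have c: "A \<in> carrier_mat m m" "B \<in> carrier_mat m m" "C \<in> carrier_mat m m" "U \<in> carrier_mat m m"
    using assms(1-3) U(1) by (simp_all only: herm_mat_def unitary_mat_def)
  have "(adj U * C * U) $$ (l, l) = (adj U * A * U) $$ (l, l) + (adj U * B * U) $$ (l, l)" if "l < m" for l
    unfolding index_conj_unitary[OF c(1,4) that that] index_conj_unitary[OF c(2,4) that that]
      index_conj_unitary[OF c(3,4) that that] sum.distrib[symmetric]
    using eq by (intro sum.cong) (auto simp: algebra_simps)
  then have "trace_norm C \<le> (\<Sum>l<m. cmod ((adj U * A * U) $$ (l, l)) + cmod ((adj U * B * U) $$ (l, l)))"
    unfolding U(2) by (intro sum_mono) (auto intro: norm_triangle_ineq simp del: index_mult_mat)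
  also have "\<dots> \<le> trace_norm A + trace_norm B"
    using sum_diagonal_le_trace_norm[OF assms(1) U(1)] sum_diagonal_le_trace_norm[OF assms(2) U(1)]
    by (simp only: sum.distrib)
  finally show ?thesis .
qed

lemma trace_norm_scale:
  assumes "herm_mat m A" "herm_mat m B"
    and eq: "\<And>j k. j < m \<Longrightarrow> k < m \<Longrightarrow> B $$ (j, k) = complex_of_real c * A $$ (j, k)"
  shows "trace_norm B = \<bar>c\<bar> * trace_norm A"
proof -
  have le: "trace_norm B \<le> \<bar>c\<bar> * trace_norm A"
    if h: "herm_mat m A" "herm_mat m B"
      "\<And>j k. j < m \<Longrightarrow> k < m \<Longrightarrow> B $$ (j, k) = complex_of_real c * A $$ (j, k)" for A B c
  proof -
    obtain U where U: "unitary_mat m U" "trace_norm B = (\<Sum>l<m. cmod ((adj U * B * U) $$ (l, l)))"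
      by (rule trace_norm_attained[OF h(2)]) (rule that)
    have car: "A \<in> carrier_mat m m" "B \<in> carrier_mat m m" "U \<in> carrier_mat m m"
      using h(1,2) U(1) by (simp_all only: herm_mat_def unitary_mat_def)
    have "(adj U * B * U) $$ (l, l) = complex_of_real c * (adj U * A * U) $$ (l, l)" if l: "l < m" for l
      unfolding index_conj_unitary[OF car(1,3) l l] index_conj_unitary[OF car(2,3) l l] sum_distrib_left
      using h(3)
      by (intro sum.cong) (auto simp: algebra_simps)
    then have "trace_norm B = (\<Sum>l<m. \<bar>c\<bar> * cmod ((adj U * A * U) $$ (l, l)))"
      unfolding U(2) by (intro sum.cong) (auto simp: norm_mult simp del: index_mult_mat)
    also have "\<dots> \<le> \<bar>c\<bar> * trace_norm A"
      unfolding sum_distrib_left[symmetric]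
      by (intro mult_left_mono sum_diagonal_le_trace_norm[OF h(1) U(1)]) auto
    finally show ?thesis .
  qed
  show ?thesis
  proof (cases "c = 0")
    case True
    then show ?thesis using le[OF assms] trace_norm_nonneg[of B] by simp
  next
    case False
    \<comment> \<open>The reverse inequality is the same estimate with \<open>A\<close> and
      \<open>B\<close> exchanged and factor \<open>1 / c\<close>.\<close>
    have "trace_norm A \<le> \<bar>1 / c\<bar> * trace_norm B"
      using False by (intro le[OF assms(2,1)]) (simp add: eq)
    then have "\<bar>c\<bar> * trace_norm A \<le> trace_norm B" using False by (simp add: field_simps)
    with le[OF assms] show ?thesis by simp
  qed
qed

text \<open>Expanding the diagonal in an eigenbasis, the entry at \<open>(a, b)\<close> appears with
  a total coefficient bounded by the product sum of two unit rows, hence by one.\<close>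

lemma trace_norm_le_sum_entries:
  assumes "herm_mat m A"
  shows "trace_norm A \<le> (\<Sum>a<m. \<Sum>b<m. cmod (A $$ (a, b)))"
proof -
  obtain U where U: "unitary_mat m U" "trace_norm A = (\<Sum>l<m. cmod ((adj U * A * U) $$ (l, l)))"
    by (rule trace_norm_attained[OF assms]) (rule that)
  have c: "A \<in> carrier_mat m m" "U \<in> carrier_mat m m"
    using assms U(1) by (simp_all only: herm_mat_def unitary_mat_def)
  have "trace_norm A \<le> (\<Sum>l<m. \<Sum>a<m. \<Sum>b<m. cmod (A $$ (a, b)) * (cmod (U $$ (a, l)) * cmod (U $$ (b, l))))"
    unfolding U(2)
  proof (intro sum_mono)
    fix l assume "l \<in> {..<m}"
    then have l: "l < m" by simp
    show "cmod ((adj U * A * U) $$ (l, l)) \<le> (\<Sum>a<m. \<Sum>b<m. cmod (A $$ (a, b)) * (cmod (U $$ (a, l)) * cmod (U $$ (b, l))))"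
      unfolding index_conj_unitary[OF c l l]
      by (intro order.trans[OF norm_sum] sum_mono) (simp add: norm_mult mult_ac)
  qed
  also have "\<dots> = (\<Sum>a<m. \<Sum>l<m. \<Sum>b<m. cmod (A $$ (a, b)) * (cmod (U $$ (a, l)) * cmod (U $$ (b, l))))"
    by (rule sum.swap)
  also have "\<dots> = (\<Sum>a<m. \<Sum>b<m. cmod (A $$ (a, b)) * (\<Sum>l<m. cmod (U $$ (a, l)) * cmod (U $$ (b, l))))"
    unfolding sum_distrib_left by (intro sum.cong refl sum.swap)
  also have "\<dots> \<le> (\<Sum>a<m. \<Sum>b<m. cmod (A $$ (a, b)))"
    using unitary_mat_rows_product_le[OF U(1)] by (intro sum_mono) (simp add: mult_left_le)
  finally show ?thesis .
qed

text \<open>In the spectral decomposition every eigenvalue is multiplied by entries of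
  \<open>U\<close>, whose moduli are at most one.\<close>

lemma entry_le_trace_norm:
  assumes "herm_mat m A" "j < m" "k < m"
  shows "cmod (A $$ (j, k)) \<le> trace_norm A"
proof -
  obtain U where U: "unitary_mat m U" "trace_norm A = (\<Sum>l<m. cmod ((adj U * A * U) $$ (l, l)))"
    "\<forall>j<m. \<forall>k<m.
      A $$ (j, k) = (\<Sum>l<m. U $$ (j, l) * (adj U * A * U) $$ (l, l) * cnj (U $$ (k, l)))"
    by (rule trace_norm_attained[OF assms(1)]) (rule that)
  have row: "cmod (U $$ (a, l)) \<le> 1" if "a < m" "l < m" for a l
  proof -
    have "(cmod (U $$ (a, l)))\<^sup>2 \<le> (\<Sum>l<m. (cmod (U $$ (a, l)))\<^sup>2)"
      using that by (intro member_le_sum) auto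
    then show ?thesis using unitary_mat_row_norm[OF U(1) that(1)] by (simp add: power_le_one_iff)
  qed
  have "cmod (U $$ (j, l) * (adj U * A * U) $$ (l, l) * cnj (U $$ (k, l))) \<le> cmod ((adj U * A * U) $$ (l, l))"
    if l: "l < m" for l
  proof -
    have "cmod (U $$ (j, l)) * cmod (U $$ (k, l)) \<le> 1"
      using row[OF assms(2) l] row[OF assms(3) l] by (intro mult_le_one) auto
    then show ?thesis
      using mult_left_le[of "cmod (U $$ (j, l)) * cmod (U $$ (k, l))" "cmod ((adj U * A * U) $$ (l, l))"]
      by (simp add: norm_mult mult_ac del: index_mult_mat)
  qed
  then show ?thesis
    unfolding U(2) U(3)[rule_format, OF assms(2,3)] by (intro order.trans[OF norm_sum] sum_mono) simp
qed

notation vec_nth (infixl "$" 90)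
no_notation vec_index (infixl "$" 100)

text \<open>The triangle inequality applied to \<open>A = B + (A - B)\<close>, with the difference
  bounded by its entries. This Lipschitz bound is the source of all later continuity and error
  estimates.\<close>

lemma trace_norm_diff_le:
  assumes "herm_mat m A" "herm_mat m B"
  shows "\<bar>trace_norm A - trace_norm B\<bar> \<le> (\<Sum>a<m. \<Sum>b<m. cmod (A $$ (a, b) - B $$ (a, b)))"
proof -
  have le: "trace_norm A \<le> trace_norm B + (\<Sum>a<m. \<Sum>b<m. cmod (A $$ (a, b) - B $$ (a, b)))"
    if h: "herm_mat m A" "herm_mat m B" for A B
  proof -
    define D where "D = Matrix.mat m m (\<lambda>(a, b). A $$ (a, b) - B $$ (a, b))"
    have ent: "D $$ (a, b) = A $$ (a, b) - B $$ (a, b)" if "a < m" "b < m" for a b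
      using that by (simp add: D_def)
    have "D $$ (k, j) = cnj (D $$ (j, k))" if "j < m" "k < m" for j k
    proof -
      have "A $$ (k, j) = cnj (A $$ (j, k))" "B $$ (k, j) = cnj (B $$ (j, k))"
        using h that unfolding herm_mat_def by blast+
      then show ?thesis unfolding ent[OF that] ent[OF that(2,1)] by (simp only: complex_cnj_diff)
    qed
    then have D: "herm_mat m D" unfolding herm_mat_def by (intro conjI) (simp add: D_def, blast)
    have "trace_norm A \<le> trace_norm B + trace_norm D"
      by (rule trace_norm_triangle[OF h(2) D h(1)]) (simp add: ent)
    also have "trace_norm D \<le> (\<Sum>a<m. \<Sum>b<m. cmod (D $$ (a, b)))"
      by (rule trace_norm_le_sum_entries[OF D])
    finally show ?thesis by (simp add: ent)
  qed
  show ?thesis using le[OF assms] le[OF assms(2,1)] by (simp add: norm_minus_commute abs_le_iff)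
qed

section \<open>Linear combinations of Hermitian tuples\<close>

lemma index_lincomb_mat:
  "j < m \<Longrightarrow> k < m \<Longrightarrow> lincomb_mat m u A $$ (j, k) = (\<Sum>i\<in>UNIV. complex_of_real (u $ i) * A i $$ (j, k))"
  by (simp add: lincomb_mat_def)

lemma herm_lincomb_mat:
  assumes "\<And>i. herm_mat m (A i)"
  shows "herm_mat m (lincomb_mat m u A)"
  unfolding herm_mat_def
proof (intro conjI allI impI)
  fix j k assume jk: "j < m" "k < m"
  have "A i $$ (k, j) = cnj (A i $$ (j, k))" for i using assms jk unfolding herm_mat_def by blast
  then show "lincomb_mat m u A $$ (k, j) = cnj (lincomb_mat m u A $$ (j, k))"
    unfolding index_lincomb_mat[OF jk] index_lincomb_mat[OF jk(2,1)] by simp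
qed (simp add: lincomb_mat_def)

lemma trace_norm_lincomb_add:
  assumes "\<And>i. herm_mat m (A i)"
  shows "trace_norm (lincomb_mat m (u + v) A) \<le> trace_norm (lincomb_mat m u A) + trace_norm (lincomb_mat m v A)"
  by (rule trace_norm_triangle[of m])
    (simp_all add: herm_lincomb_mat assms index_lincomb_mat algebra_simps sum.distrib)

lemma trace_norm_lincomb_scale:
  assumes "\<And>i. herm_mat m (A i)"
  shows "trace_norm (lincomb_mat m (c *\<^sub>R u) A) = \<bar>c\<bar> * trace_norm (lincomb_mat m u A)"
  by (rule trace_norm_scale[of m])
    (simp_all add: herm_lincomb_mat assms index_lincomb_mat algebra_simps sum_distrib_left)

lemma trace_norm_lincomb_minus:
  assumes "\<And>i. herm_mat m (A i)"
  shows "trace_norm (lincomb_mat m (- u) A) = trace_norm (lincomb_mat m u A)"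
  using trace_norm_lincomb_scale[OF assms, of "-1" u] by simp

text \<open>Homogeneity in the tuple rather than in \<open>u\<close>: it moves probability weights
  into the matrices and back out.\<close>

lemma trace_norm_lincomb_scale_mat:
  assumes "\<And>i. herm_mat m (A i)" "\<And>i. herm_mat m (B i)"
    and "\<And>i j k. j < m \<Longrightarrow> k < m \<Longrightarrow> B i $$ (j, k) = complex_of_real c * A i $$ (j, k)"
  shows "trace_norm (lincomb_mat m u B) = \<bar>c\<bar> * trace_norm (lincomb_mat m u A)"
  by (rule trace_norm_scale[of m])
    (simp_all add: herm_lincomb_mat assms index_lincomb_mat algebra_simps sum_distrib_left)

text \<open>Coordinate vectors pick out single matrices, so the values there control the size of a
  whole tuple.\<close>

lemma trace_norm_lincomb_axis:
  assumes "A i \<in> carrier_mat m m"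
  shows "trace_norm (lincomb_mat m (axis i 1) A) = trace_norm (A i)"
proof -
  have "lincomb_mat m (axis i 1) A = A i"
  proof (rule eq_matI)
    fix j k assume "j < dim_row (A i)" "k < dim_col (A i)"
    then have jk: "j < m" "k < m" using assms by auto
    have "lincomb_mat m (axis i 1) A $$ (j, k) = (\<Sum>i'\<in>UNIV. if i' = i then A i $$ (j, k) else 0)"
      unfolding index_lincomb_mat[OF jk] by (intro sum.cong) (simp_all add: axis_def)
    then show "lincomb_mat m (axis i 1) A $$ (j, k) = A i $$ (j, k)" by simp
  qed (use assms in \<open>auto simp: lincomb_mat_def\<close>)
  then show ?thesis by simp
qed

text \<open>Coordinates of a unit vector are at most one in modulus, so the bound is uniform over
  the sphere, as the Hausdorff distance requires.\<close>

lemma trace_norm_lincomb_diff_le: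
  fixes u :: "real ^ 'd"
  assumes "\<And>i. herm_mat m (A i)" "\<And>i. herm_mat m (B i)" "norm u = 1"
  shows "\<bar>trace_norm (lincomb_mat m u A) - trace_norm (lincomb_mat m u B)\<bar>
    \<le> (\<Sum>i\<in>UNIV. \<Sum>a<m. \<Sum>b<m. cmod (A i $$ (a, b) - B i $$ (a, b)))"
proof -
  have u: "\<bar>u $ i\<bar> \<le> 1" for i using component_le_norm_cart[of u i] assms(3) by simp
  have "\<bar>trace_norm (lincomb_mat m u A) - trace_norm (lincomb_mat m u B)\<bar>
    \<le> (\<Sum>a<m. \<Sum>b<m. cmod (lincomb_mat m u A $$ (a, b) - lincomb_mat m u B $$ (a, b)))"
    by (intro trace_norm_diff_le herm_lincomb_mat assms)
  also have "\<dots> \<le> (\<Sum>a<m. \<Sum>b<m. \<Sum>i\<in>UNIV. cmod (A i $$ (a, b) - B i $$ (a, b)))"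
  proof (intro sum_mono)
    fix a b assume "a \<in> {..<m}" "b \<in> {..<m}"
    then have "lincomb_mat m u A $$ (a, b) - lincomb_mat m u B $$ (a, b)
        = (\<Sum>i\<in>UNIV. complex_of_real (u $ i) * (A i $$ (a, b) - B i $$ (a, b)))"
      by (simp add: index_lincomb_mat sum_subtractf algebra_simps)
    also have "cmod \<dots> \<le> (\<Sum>i\<in>UNIV. cmod (A i $$ (a, b) - B i $$ (a, b)))"
      using u by (intro order.trans[OF norm_sum] sum_mono) (simp add: norm_mult mult_left_le_one_le)
    finally show "cmod (lincomb_mat m u A $$ (a, b) - lincomb_mat m u B $$ (a, b))
      \<le> (\<Sum>i\<in>UNIV. cmod (A i $$ (a, b) - B i $$ (a, b)))" .
  qed
  also have "\<dots> = (\<Sum>a<m. \<Sum>i\<in>UNIV. \<Sum>b<m. cmod (A i $$ (a, b) - B i $$ (a, b)))"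
    by (intro sum.cong refl sum.swap)
  also have "\<dots> = (\<Sum>i\<in>UNIV. \<Sum>a<m. \<Sum>b<m. cmod (A i $$ (a, b) - B i $$ (a, b)))"
    by (rule sum.swap)
  finally show ?thesis .
qed

text \<open>The average of an array with its conjugate transpose. It keeps matrices Hermitian when
  their entries are constructed independently of each other.\<close>

definition herm_part :: "nat \<Rightarrow> (nat \<Rightarrow> nat \<Rightarrow> complex) \<Rightarrow> complex mat" where
  "herm_part m S = Matrix.mat m m (\<lambda>(j, k). (S j k + cnj (S k j)) / 2)"

lemma herm_part_herm: "herm_mat m (herm_part m S)"
  unfolding herm_mat_def herm_part_def by auto

lemma herm_part_self:
  assumes "herm_mat m A" "\<And>j k. j < m \<Longrightarrow> k < m \<Longrightarrow> S j k = A $$ (j, k)"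
  shows "herm_part m S = A"
proof (rule eq_matI)
  fix j k assume "j < dim_row A" "k < dim_col A"
  then have jk: "j < m" "k < m" using herm_mat_carrier[OF assms(1)] by auto
  then have "A $$ (j, k) = cnj (A $$ (k, j))" using assms(1) unfolding herm_mat_def by blast
  then have "cnj (S k j) = S j k" unfolding assms(2)[OF jk] assms(2)[OF jk(2,1)] by (rule sym)
  then show "herm_part m S $$ (j, k) = A $$ (j, k)" using jk assms(2)[OF jk] by (simp add: herm_part_def)
qed (use herm_mat_carrier[OF assms(1)] in \<open>auto simp: herm_part_def\<close>)

section \<open>Support functions\<close>

lemma bdd_above_inner_image:
  fixes K :: "(real ^ 'd) set"
  assumes "bounded K"
  shows "bdd_above ((\<lambda>x. inner u x) ` K)"
  using bounded_imp_bdd_above[OF bounded_linear_image[OF assms bounded_linear_inner_right]] .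

lemma abs_supp_fun_le:
  assumes "K \<noteq> {}" "\<And>x. x \<in> K \<Longrightarrow> norm x \<le> b"
  shows "\<bar>supp_fun K u\<bar> \<le> norm u * b"
proof -
  have le: "\<bar>inner u x\<bar> \<le> norm u * b" if "x \<in> K" for x
    using Cauchy_Schwarz_ineq2[of u x] assms(2)[OF that] mult_left_mono[of "norm x" b "norm u"] by simp
  have bdd: "bdd_above ((\<lambda>x. inner u x) ` K)"
    using assms(2) by (intro bdd_above_inner_image) (auto simp: bounded_iff)
  obtain x where x: "x \<in> K" using assms(1) by auto
  have "supp_fun K u \<le> norm u * b"
    unfolding supp_fun_def using assms(1) le by (intro cSUP_least) (auto simp: abs_le_iff)
  moreover have "- (norm u * b) \<le> supp_fun K u"
    unfolding supp_fun_def using le[OF x] by (intro cSUP_upper2[OF bdd x]) auto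
  ultimately show ?thesis by simp
qed

lemma supp_fun_minus:
  assumes "uminus ` K = K"
  shows "supp_fun K (- u) = supp_fun K u"
proof -
  have "(\<lambda>x. inner (- u) x) ` K = (\<lambda>x. inner u x) ` uminus ` K" by (auto simp: image_image)
  then show ?thesis by (simp add: supp_fun_def assms)
qed

text \<open>Compactness bounds both support functions on the sphere, so the real supremum really is
  an upper bound.\<close>

lemma hausdorff_dist_upper:
  fixes K L :: "(real ^ 'd) set"
  assumes "convex_body K" "convex_body L" "norm u = 1"
  shows "\<bar>supp_fun K u - supp_fun L u\<bar> \<le> hausdorff_dist K L"
proof -
  have "bounded K" "bounded L" using assms by (auto simp: convex_body_def compact_imp_bounded)
  then obtain b c where b: "\<And>x. x \<in> K \<Longrightarrow> norm x \<le> b" and c: "\<And>x. x \<in> L \<Longrightarrow> norm x \<le> c"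
    by (meson bounded_iff)
  have "\<bar>supp_fun K v - supp_fun L v\<bar> \<le> b + c" if "norm v = 1" for v
    using abs_supp_fun_le[of K b v] abs_supp_fun_le[of L c v] b c assms that
    by (auto simp: convex_body_def)
  then have "bdd_above ((\<lambda>u. \<bar>supp_fun K u - supp_fun L u\<bar>) ` sphere 0 1)"
    by (intro bdd_aboveI[of _ "b + c"]) auto
  then show ?thesis unfolding hausdorff_dist_def using assms(3) by (intro cSUP_upper) auto
qed

lemma hausdorff_dist_le:
  fixes K L :: "(real ^ 'd) set"
  assumes "\<And>u. norm u = 1 \<Longrightarrow> \<bar>supp_fun K u - supp_fun L u\<bar> \<le> e"
  shows "hausdorff_dist K L \<le> e"
proof -
  have "sphere (0 :: real ^ 'd) 1 \<noteq> {}" using norm_axis_1 by (metis empty_iff mem_sphere_0)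
  then show ?thesis unfolding hausdorff_dist_def by (intro cSUP_least) (auto simp: assms)
qed

section \<open>Even sublinear functions as support functions\<close>

text \<open>A finite-dimensional Hahn-Banach argument: \<open>K\<close> consists of the linear
  functionals dominated by \<open>h\<close>, and separating a point just below the graph from the
  epigraph produces a functional that nearly attains \<open>h u\<close>. Evenness makes
  \<open>K\<close> symmetric and bounds its coordinates on both sides.\<close>

lemma sublinear_is_supp_fun:
  fixes h :: "real ^ 'd \<Rightarrow> real"
  assumes add: "\<And>u v. h (u + v) \<le> h u + h v"
    and scale: "\<And>c u. c > 0 \<Longrightarrow> h (c *\<^sub>R u) = c * h u"
    and even: "\<And>u. h (- u) = h u"
  shows "\<exists>K. convex_body K \<and> uminus ` K = K \<and> supp_fun K = h"
proof -
  define K where "K = {x. \<forall>u. inner u x \<le> h u}"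
  have h0: "h 0 = 0" using scale[of 2 0] by simp
  have convex_h: "convex_on UNIV h"
  proof (rule convex_onI)
    fix t :: real and x y :: "real ^ 'd" assume "0 < t" "t < 1"
    then show "h ((1 - t) *\<^sub>R x + t *\<^sub>R y) \<le> (1 - t) * h x + t * h y"
      using add[of "(1 - t) *\<^sub>R x" "t *\<^sub>R y"] scale[of "1 - t" x] scale[of t y] by simp
  qed simp
  then have cont: "continuous_on UNIV h" by (intro convex_on_continuous) auto
  have near: "\<exists>x\<in>K. inner u x > h u - e" if e: "e > 0" for u e
  proof -
    define E where "E = {p :: (real ^ 'd) \<times> real. h (fst p) \<le> snd p}"
    have "closed E" unfolding E_def
      by (intro closed_Collect_le continuous_intros continuous_on_compose2[OF cont]) auto
    moreover have "convex E"
      using convex_h convex_epigraph[of UNIV h] by (simp add: E_def epigraph_def)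
    moreover have "(u, h u - e) \<notin> E" using e by (simp add: E_def)
    ultimately obtain a b where ab: "inner a (u, h u - e) < b" "\<And>p. p \<in> E \<Longrightarrow> inner a p > b"
      using separating_hyperplane_closed_point[of E "(u, h u - e)"] by blast
    obtain a1 a2 where a: "a = (a1, a2)" by (cases a)
    have b0: "b < 0" using ab(2)[of 0] h0 by (simp add: E_def)
    \<comment> \<open>The epigraph is a cone: a point where the functional is negative could be
      scaled to give exactly the value \<open>b\<close>, against strict separation.\<close>
    have pos: "inner a p \<ge> 0" if p: "p \<in> E" for p
    proof (rule ccontr)
      assume n: "\<not> inner a p \<ge> 0"
      define c where "c = b / inner a p"
      have c: "c > 0" using n b0 by (simp add: c_def divide_neg_neg)
      have "c *\<^sub>R p \<in> E" using p c scale[OF c] by (auto simp: E_def mult_left_mono)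
      then have "c * inner a p > b" using ab(2) by fastforce
      then show False using n by (simp add: c_def)
    qed
    have "inner a (u, h u) \<ge> 0" by (intro pos) (simp add: E_def)
    then have "a2 * e > 0" using ab(1) b0 by (simp add: a algebra_simps)
    \<comment> \<open>The hyperplane is not vertical, so it is the graph of a linear functional; its
      slope is the required point of \<open>K\<close>.\<close>
    then have a2: "a2 > 0" using e by (simp add: zero_less_mult_iff)
    define x where "x = (- 1 / a2) *\<^sub>R a1"
    have "inner v x \<le> h v" for v
    proof -
      have "inner a (v, h v) \<ge> 0" by (intro pos) (simp add: E_def)
      then show ?thesis using a2 by (simp add: a x_def inner_commute field_simps)
    qed
    moreover have "inner u x > h u - e"
      using ab(1) b0 a2 by (simp add: a x_def inner_commute field_simps)
    ultimately show ?thesis by (auto simp: K_def)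
  qed
  have ne: "K \<noteq> {}" using near[of 1 0] by auto
  have "closed K"
  proof -
    have "K = (\<Inter>u. {x. inner u x \<le> h u})" by (auto simp: K_def)
    then show ?thesis by (auto intro!: closed_INT closed_halfspace_le)
  qed
  moreover have "bounded K"
  proof (rule bounded_subset)
    show "K \<subseteq> cbox (\<chi> i. - h (axis i 1)) (\<chi> i. h (axis i 1))"
    proof
      fix x assume x: "x \<in> K"
      have "\<bar>x $ i\<bar> \<le> h (axis i 1)" for i
        using x[unfolded K_def, simplified, rule_format, of "axis i 1"]
          x[unfolded K_def, simplified, rule_format, of "- axis i 1"] even[of "axis i 1"]
        by (simp add: inner_axis' abs_le_iff)
      then show "x \<in> cbox (\<chi> i. - h (axis i 1)) (\<chi> i. h (axis i 1))"
        by (auto simp: mem_box_cart abs_le_iff minus_le_iff)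
    qed
  qed simp
  moreover have "convex K"
  proof -
    have "K = (\<Inter>u. {x. inner u x \<le> h u})" by (auto simp: K_def)
    then show ?thesis by (auto intro!: convex_INT convex_halfspace_le)
  qed
  ultimately have "convex_body K" using ne by (simp add: convex_body_def compact_eq_bounded_closed)
  moreover have "uminus ` K = K"
  proof -
    have "- x \<in> K" if "x \<in> K" for x
    proof -
      have "inner u (- x) \<le> h u" for u
        using that[unfolded K_def, simplified, rule_format, of "- u"] even[of u] by simp
      then show ?thesis by (simp add: K_def)
    qed
    then show ?thesis by (metis (no_types, lifting) add.inverse_inverse image_eqI image_subset_iff subsetI subset_antisym)
  qed
  moreover have "supp_fun K = h"
  proof
    fix u
    have "supp_fun K u \<le> h u"
      unfolding supp_fun_def using ne by (intro cSUP_least) (auto simp: K_def)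
    moreover have "h u \<le> supp_fun K u"
    proof (rule field_le_epsilon)
      fix e :: real assume "e > 0"
      then obtain x where x: "x \<in> K" "inner u x > h u - e" using near by blast
      have "inner u x \<le> supp_fun K u"
        unfolding supp_fun_def using x \<open>bounded K\<close> by (intro cSUP_upper bdd_above_inner_image)
      then show "h u \<le> supp_fun K u + e" using x by simp
    qed
    ultimately show "supp_fun K u = h u" by simp
  qed
  ultimately show ?thesis by blast
qed

lemma centrally_symmetric_uminus:
  assumes "uminus ` K = K"
  shows "centrally_symmetric K"
  unfolding centrally_symmetric_def using assms by (intro exI[of _ 0]) auto

section \<open>A space-filling curve of matrix tuples\<close>

text \<open>A clipped cosine of period 2 that vanishes on \<open>[0, 1/3]\<close> and equals 1 on
  \<open>[2/3, 1]\<close>. It stands in for the usual piecewise linear function, so continuity is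
  immediate.\<close>

definition wave :: "real \<Rightarrow> real" where
  "wave t = max 0 (min 1 (1 / 2 - cos (pi * t)))"

lemma wave_bounds: "0 \<le> wave t" "wave t \<le> 1"
  by (auto simp: wave_def)

lemma continuous_wave: "continuous_on S wave"
  unfolding wave_def by (intro continuous_intros)

text \<open>Periodicity discards the even integer \<open>2 * n\<close>. The remaining fraction lies
  in \<open>[0, 1/3]\<close> or \<open>[2/3, 1]\<close> according to the digit \<open>b\<close>,
  where the clipping takes effect.\<close>

lemma wave_digit:
  fixes n b :: nat and s :: real
  assumes "b = 0 \<or> b = 1" "0 \<le> s" "s \<le> 1"
  shows "wave (2 * real n + (2 * real b + s) / 3) = real b"
proof -
  define y where "y = (2 * real b + s) / 3"
  have "cos (pi * (2 * real n + y)) = cos (pi * y + 2 * real n * pi)"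
    by (simp add: algebra_simps)
  also have "\<dots> = cos (pi * y)"
    by (simp add: cos_add cos_2npi sin_2npi)
  finally have per: "cos (pi * (2 * real n + y)) = cos (pi * y)" .
  show ?thesis
  proof (cases "b = 0")
    case True
    then have "cos (pi / 3) \<le> cos (pi * y)"
      using assms by (intro cos_monotone_0_pi_le) (auto simp: y_def field_simps)
    then show ?thesis unfolding y_def[symmetric] wave_def per using True by (simp add: cos_60)
  next
    case False
    then have b: "b = 1" using assms by simp
    then have "cos (pi * y) \<le> cos (2 * pi / 3)"
      using assms by (intro cos_monotone_0_pi_le) (auto simp: y_def field_simps)
    then show ?thesis unfolding y_def[symmetric] wave_def per using b by (simp add: cos_120)
  qed
qed

text \<open>Schoenberg's space-filling curve with countably many coordinates: the wave of frequency
  \<open>3 ^ l\<close> reads off the \<open>l\<close>-th ternary digit of a point of the Cantor set, and the digits are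
  distributed over the coordinates by pairing.\<close>

definition space_curve :: "nat \<Rightarrow> real \<Rightarrow> real" where
  "space_curve i t = (\<Sum>k. wave (3 ^ prod_encode (i, k) * t) * (1 / 2) ^ Suc k)"

lemma summable_half: "summable (\<lambda>k. (1 / 2 :: real) ^ Suc k)"
  using power_half_series sums_summable by blast

lemma summable_space_curve: "summable (\<lambda>k. wave (3 ^ prod_encode (i, k) * t) * (1 / 2) ^ Suc k)"
  by (rule summable_comparison_test'[OF summable_half, of 0])
    (use wave_bounds in \<open>auto simp: abs_mult intro!: mult_left_le_one_le\<close>)

lemma space_curve_bounds: "0 \<le> space_curve i t" "space_curve i t \<le> 1"
proof -
  show "0 \<le> space_curve i t"
    unfolding space_curve_def by (intro suminf_nonneg summable_space_curve) (simp add: wave_bounds)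
  have "space_curve i t \<le> (\<Sum>k. (1 / 2 :: real) ^ Suc k)"
    unfolding space_curve_def
    by (intro suminf_le summable_space_curve summable_half)
      (use wave_bounds in \<open>auto intro!: mult_left_le_one_le\<close>)
  then show "space_curve i t \<le> 1" using power_half_series by (simp add: sums_unique[symmetric])
qed

text \<open>The partial sums are continuous and converge uniformly by the Weierstrass M-test against
  the geometric series.\<close>

lemma continuous_space_curve: "continuous_on UNIV (space_curve i)"
proof -
  have "uniform_limit UNIV (\<lambda>n t. \<Sum>k<n. wave (3 ^ prod_encode (i, k) * t) * (1 / 2) ^ Suc k)
      (space_curve i) sequentially"
    unfolding space_curve_def[abs_def]
    by (rule Weierstrass_m_test[OF _ summable_half])
      (use wave_bounds in \<open>auto simp: abs_mult intro!: mult_left_le_one_le\<close>)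
  then show ?thesis
    by (rule uniform_limit_theorem[rotated])
      (auto intro!: always_eventually continuous_intros continuous_on_compose2[OF continuous_wave])
qed

text \<open>Iterate the doubling map on \<open>[0, 1)\<close> and record whether each iterate
  reaches \<open>1 / 2\<close>; after \<open>n\<close> digits the remainder is
  \<open>y n * (1 / 2) ^ n\<close>.\<close>

lemma binary_expansion:
  fixes x :: real
  assumes "0 \<le> x" "x < 1"
  shows "\<exists>b :: nat \<Rightarrow> nat. (\<forall>k. b k = 0 \<or> b k = 1) \<and> (\<lambda>k. real (b k) * (1 / 2) ^ Suc k) sums x"
proof -
  define dg :: "real \<Rightarrow> nat" where "dg y = (if y \<ge> 1 / 2 then 1 else 0)" for y
  define y where "y k = ((\<lambda>y. 2 * y - real (dg y)) ^^ k) x" for k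
  have y: "0 \<le> y k \<and> y k < 1" for k
    by (induction k) (use assms in \<open>auto simp: y_def dg_def\<close>)
  have partial: "(\<Sum>k<n. real (dg (y k)) * (1 / 2) ^ Suc k) = x - y n * (1 / 2) ^ n" for n
  proof (induction n)
    case 0
    show ?case by (simp add: y_def)
  next
    case (Suc n)
    have "y (Suc n) = 2 * y n - real (dg (y n))" by (simp add: y_def)
    then show ?case unfolding sum.lessThan_Suc Suc.IH by (simp add: field_simps)
  qed
  have "(\<lambda>n. y n * (1 / 2) ^ n) \<longlonglongrightarrow> 0"
  proof (rule tendsto_sandwich[OF _ _ tendsto_const])
    show "(\<lambda>n. (1 / 2 :: real) ^ n) \<longlonglongrightarrow> 0" by (intro LIMSEQ_realpow_zero) auto
  qed (use y in \<open>auto intro!: always_eventually mult_left_le_one_le less_imp_le\<close>)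
  then have "(\<lambda>n. x - y n * (1 / 2) ^ n) \<longlonglongrightarrow> x - 0" by (intro tendsto_intros)
  then have "(\<lambda>k. real (dg (y k)) * (1 / 2) ^ Suc k) sums x"
    unfolding sums_def partial by simp
  then show ?thesis by (intro exI[of _ "\<lambda>k. dg (y k)"]) (auto simp: dg_def)
qed

text \<open>The point of the Cantor set with ternary digits \<open>2 * b l\<close>. Multiplying by
  \<open>3 ^ l\<close> turns the digits already passed into an even integer and leaves
  \<open>b l\<close> as the leading digit.\<close>

lemma ternary_point:
  fixes b :: "nat \<Rightarrow> nat"
  assumes b: "\<And>l. b l = 0 \<or> b l = 1"
  shows "\<exists>t. 0 \<le> t \<and> t \<le> 1 \<and> (\<forall>l. wave (3 ^ l * t) = real (b l))"
proof -
  \<comment> \<open>The number formed by the digits from position \<open>l\<close> on; the required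
    point is \<open>tail 0\<close>.\<close>
  define tail where "tail l = (\<Sum>j. 2 * real (b (l + j)) * (1 / 3) ^ Suc j)" for l
  have geo: "(\<lambda>j. 2 * (1 / 3 :: real) ^ Suc j) sums 1"
    using sums_mult[OF geometric_sums[of "1 / 3 :: real"], of "2 / 3"] by simp
  have sm: "summable (\<lambda>j. 2 * real (b (l + j)) * (1 / 3) ^ Suc j)" for l
  proof (rule summable_comparison_test'[OF sums_summable[OF geo], of 0])
    fix j
    show "norm (2 * real (b (l + j)) * (1 / 3) ^ Suc j) \<le> 2 * (1 / 3) ^ Suc j"
      using b[of "l + j"] by auto
  qed
  have tail: "0 \<le> tail l" "tail l \<le> 1" for l
  proof -
    show "0 \<le> tail l" unfolding tail_def by (intro suminf_nonneg sm) auto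
    have "tail l \<le> (\<Sum>j. 2 * (1 / 3 :: real) ^ Suc j)"
      unfolding tail_def
    proof (intro suminf_le sm sums_summable[OF geo])
      fix j show "2 * real (b (l + j)) * (1 / 3) ^ Suc j \<le> 2 * (1 / 3) ^ Suc j"
        using b[of "l + j"] by auto
    qed
    then show "tail l \<le> 1" using sums_unique[OF geo] by simp
  qed
  have tail_rec: "tail l = (2 * real (b l) + tail (Suc l)) / 3" for l
  proof -
    have "tail (Suc l) / 3 = (\<Sum>j. 2 * real (b (l + Suc j)) * (1 / 3) ^ Suc (Suc j))"
      unfolding tail_def suminf_divide[OF sm, symmetric] by simp
    also have "\<dots> = tail l - 2 * real (b l) / 3"
      unfolding tail_def by (subst suminf_split_head[OF sm]) simp
    finally show ?thesis by (simp add: field_simps)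
  qed
  have shift: "\<exists>n::nat. 3 ^ l * tail 0 = 2 * real n + tail l" for l
  proof (induction l)
    case 0
    show ?case by (intro exI[of _ 0]) simp
  next
    case (Suc l)
    then obtain n :: nat where "3 ^ l * tail 0 = 2 * real n + tail l" by blast
    then have "3 ^ Suc l * tail 0 = 2 * real (3 * n + b l) + tail (Suc l)"
      using tail_rec[of l] by (simp add: field_simps)
    then show ?case by blast
  qed
  have "wave (3 ^ l * tail 0) = real (b l)" for l
  proof -
    obtain n :: nat where "3 ^ l * tail 0 = 2 * real n + tail l" using shift by blast
    then show ?thesis using wave_digit[OF b[of l] tail(1)[of "Suc l"] tail(2)[of "Suc l"], of n] tail_rec[of l] by simp
  qed
  then show ?thesis using tail by blast
qed

text \<open>The binary digits of all coordinates are interleaved by the pairing function into one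
  sequence, which a single Cantor point encodes.\<close>

lemma space_curve_surj:
  assumes "\<And>i. 0 \<le> x i \<and> x i < 1"
  shows "\<exists>t. 0 \<le> t \<and> t \<le> 1 \<and> (\<forall>i. space_curve i t = x i)"
proof -
  have "\<forall>i. \<exists>b :: nat \<Rightarrow> nat. (\<forall>k. b k = 0 \<or> b k = 1) \<and> (\<lambda>k. real (b k) * (1 / 2) ^ Suc k) sums x i"
    using binary_expansion assms by blast
  then obtain b :: "nat \<Rightarrow> nat \<Rightarrow> nat" where b: "\<And>i k. b i k = 0 \<or> b i k = 1"
    "\<And>i. (\<lambda>k. real (b i k) * (1 / 2) ^ Suc k) sums x i" by metis
  have "case_prod b p = 0 \<or> case_prod b p = 1" for p using b(1) by (cases p) auto
  then have "\<exists>t. 0 \<le> t \<and> t \<le> 1 \<and> (\<forall>l. wave (3 ^ l * t) = real (case_prod b (prod_decode l)))"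
    by (intro ternary_point)
  then obtain t where t: "0 \<le> t" "t \<le> 1" "\<And>l. wave (3 ^ l * t) = real (case_prod b (prod_decode l))"
    by blast
  have "space_curve i t = x i" for i
    unfolding space_curve_def using b(2)[of i] by (simp add: t(3) sums_unique[symmetric])
  then show ?thesis using t by blast
qed

section \<open>A curve through all bounded Hermitian tuples\<close>

text \<open>Real and imaginary parts of the entries have separate coordinates, stretched from
  \<open>[0, 1]\<close> to \<open>[- 2 * c, 2 * c]\<close>. The margin places targets of size at
  most \<open>c\<close> in \<open>[1/4, 3/4]\<close>, away from the value 1 that
  \<open>space_curve_surj\<close> excludes.\<close>

definition herm_curve :: "nat \<Rightarrow> real \<Rightarrow> real \<Rightarrow> 'd::finite \<Rightarrow> complex mat" where
  "herm_curve m c t i = herm_part m (\<lambda>j k. Complex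
     (c * (4 * space_curve (to_nat (i, j, k, False)) t - 2))
     (c * (4 * space_curve (to_nat (i, j, k, True)) t - 2)))"

lemma herm_curve_herm: "herm_mat m (herm_curve m c t i)"
  unfolding herm_curve_def by (rule herm_part_herm)

lemma continuous_herm_curve:
  assumes "j < m" "k < m"
  shows "continuous_on UNIV (\<lambda>t. herm_curve m c t i $$ (j, k))"
proof -
  have "continuous_on UNIV (\<lambda>t. (Complex (c * (4 * space_curve a t - 2)) (c * (4 * space_curve b t - 2))
      + cnj (Complex (c * (4 * space_curve a' t - 2)) (c * (4 * space_curve b' t - 2)))) / 2)" for a b a' b'
    unfolding Complex_eq by (intro continuous_intros continuous_space_curve) auto
  then show ?thesis using assms by (simp add: herm_curve_def herm_part_def)
qed

lemma herm_curve_bounded: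
  assumes "j < m" "k < m"
  shows "cmod (herm_curve m c t i $$ (j, k)) \<le> 4 * \<bar>c\<bar>"
proof -
  have le: "cmod (Complex (c * (4 * space_curve a t - 2)) (c * (4 * space_curve b t - 2))) \<le> 4 * \<bar>c\<bar>" for a b
  proof -
    have "\<bar>c * (4 * space_curve a t - 2)\<bar> \<le> 2 * \<bar>c\<bar>" for a
      using space_curve_bounds[of a t] mult_right_mono[of "\<bar>4 * space_curve a t - 2\<bar>" 2 "\<bar>c\<bar>"]
      by (simp add: abs_mult abs_le_iff mult.commute)
    then show ?thesis
      using cmod_le[of "Complex (c * (4 * space_curve a t - 2)) (c * (4 * space_curve b t - 2))"]
      by (smt (verit) complex.sel)
  qed
  show ?thesis using assms
    by (simp add: herm_curve_def herm_part_def norm_divide)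
      (rule order.trans[OF norm_triangle_ineq], smt (verit) le complex_mod_cnj)
qed

lemma herm_curve_surj:
  fixes B :: "'d::finite \<Rightarrow> complex mat"
  assumes B: "\<And>i. herm_mat m (B i)" "\<And>i j k. j < m \<Longrightarrow> k < m \<Longrightarrow> cmod (B i $$ (j, k)) \<le> c" and c: "c > 0"
  shows "\<exists>t. 0 \<le> t \<and> t \<le> 1 \<and> (\<forall>i. herm_curve m c t i = B i)"
proof -
  \<comment> \<open>The inverse of the affine stretching; index pairs outside the matrix receive the
    harmless coordinate 0.\<close>
  define val where "val = (\<lambda>(i :: 'd, j, k, im). if j < m \<and> k < m then
      ((if im then Im (B i $$ (j, k)) else Re (B i $$ (j, k))) / c + 2) / 4 else 0)"
  have "0 \<le> val p \<and> val p < 1" for p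
  proof -
    obtain i j k im where p: "p = (i, j, k, im)" by (cases p)
    define y where "y = (if im then Im (B i $$ (j, k)) else Re (B i $$ (j, k))) / c"
    have "\<bar>y\<bar> \<le> 1" if "j < m" "k < m"
      using B(2)[OF that, of i] abs_Re_le_cmod[of "B i $$ (j, k)"] abs_Im_le_cmod[of "B i $$ (j, k)"] c
      by (auto simp: y_def)
    moreover have "val p = (if j < m \<and> k < m then (y + 2) / 4 else 0)"
      by (simp add: p val_def y_def)
    ultimately show ?thesis by (auto simp: abs_le_iff)
  qed
  then obtain t where t: "0 \<le> t" "t \<le> 1" "\<And>n. space_curve n t = val (from_nat n)"
    using space_curve_surj[of "\<lambda>n. val (from_nat n)"] by blast
  have "herm_curve m c t i = B i" for i
    unfolding herm_curve_def
    by (rule herm_part_self[OF B(1)]) (use c in \<open>simp add: t(3) val_def complex_eq_iff field_simps\<close>)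
  then show ?thesis using t by blast
qed

section \<open>From operanoids to random matrices\<close>

text \<open>All the mass lies in \<open>[0, 1]\<close>, so the measures are tight and Helly
  selection gives a weakly convergent subsequence.\<close>

lemma discrete_weak_limit:
  fixes w t :: "nat \<Rightarrow> nat \<Rightarrow> real" and N :: "nat \<Rightarrow> nat"
  assumes w: "\<And>k j. w k j \<ge> 0" "\<And>k. (\<Sum>j<N k. w k j) = 1"
    and t: "\<And>k j. 0 \<le> t k j \<and> t k j \<le> 1"
  shows "\<exists>s \<nu>. strict_mono s \<and> real_distribution \<nu> \<and> (\<forall>(f :: real \<Rightarrow> real) B. (\<forall>x. isCont f x) \<longrightarrow> (\<forall>x. \<bar>f x\<bar> \<le> B) \<longrightarrow>
    (\<lambda>k. \<Sum>j<N (s k). w (s k) j * f (t (s k) j)) \<longlonglongrightarrow> integral\<^sup>L \<nu> f)"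
proof -
  \<comment> \<open>The weights live on the indices and are then pushed forward along
    \<open>t k\<close>, so coinciding points cause no trouble.\<close>
  define P where "P k = point_measure {..<N k} (\<lambda>j. ennreal (w k j))" for k
  have P: "prob_space (P k)" for k
  proof (rule prob_spaceI)
    show "emeasure (P k) (space (P k)) = 1"
      by (simp add: P_def space_point_measure emeasure_point_measure_finite w sum_ennreal)
  qed
  have tm: "t k \<in> borel_measurable (P k)" for k by (simp add: P_def space_point_measure)
  define \<mu> where "\<mu> k = distr (P k) borel (t k)" for k
  have rd: "real_distribution (\<mu> k)" for k
    unfolding \<mu>_def using prob_space.real_distribution_distr[OF P tm] .
  \<comment> \<open>Tightness is phrased with intervals open on the left, so the left end lies below
    0.\<close>
  have "measure (\<mu> k) {-1<..1} = 1" for k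
  proof -
    interpret P: prob_space "P k" by (rule P)
    have "-1 < t k j" for j using t[of k j] by linarith
    then have "t k -` {-1<..1} \<inter> space (P k) = space (P k)"
      using t[of k] by auto
    then show ?thesis using tm by (simp add: \<mu>_def measure_distr P.prob_space)
  qed
  then have "tight \<mu>"
    unfolding tight_def
  proof (intro conjI allI impI rd)
    fix e :: real assume "e > 0"
    then show "\<exists>a b. a < b \<and> (\<forall>k. measure (\<mu> k) {a<..b} > 1 - e)"
      using \<open>\<And>k. measure (\<mu> k) {-1<..1} = 1\<close> by (intro exI[of _ "-1"] exI[of _ 1]) simp
  qed
  then obtain s \<nu> where s: "strict_mono s" "real_distribution \<nu>" "weak_conv_m (\<lambda>k. \<mu> (s k)) \<nu>"
    using tight_imp_convergent_subsubsequence[of \<mu> id] by (auto simp: strict_mono_id o_def)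
  have "(\<lambda>k. \<Sum>j<N (s k). w (s k) j * f (t (s k) j)) \<longlonglongrightarrow> integral\<^sup>L \<nu> f"
    if f: "\<And>x. isCont f x" "\<And>x. \<bar>f x\<bar> \<le> B" for f :: "real \<Rightarrow> real" and B
  proof -
    have "f \<in> borel_measurable borel"
      using f(1) by (intro borel_measurable_continuous_onI continuous_at_imp_continuous_on) auto
    then have "integral\<^sup>L (\<mu> k) f = (\<Sum>j<N k. w k j * f (t k j))" for k
      unfolding \<mu>_def using tm w(1)
      by (subst integral_distr) (simp_all add: P_def lebesgue_integral_point_measure_finite)
    moreover have "(\<lambda>k. integral\<^sup>L (\<mu> (s k)) f) \<longlonglongrightarrow> integral\<^sup>L \<nu> f"
      using s f by (intro weak_conv_imp_integral_bdd_continuous_conv[where B = B] rd) simp_all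
    ultimately show ?thesis by simp
  qed
  with s show ?thesis by blast
qed

section \<open>The trace norm along the curve\<close>

lemma trace_norm_lincomb_zero:
  assumes "\<And>i. herm_mat m (A i)" "\<And>i j k. j < m \<Longrightarrow> k < m \<Longrightarrow> A i $$ (j, k) = 0"
  shows "trace_norm (lincomb_mat m u A) = 0"
  using trace_norm_lincomb_scale_mat[of m A A 0 u] assms by simp

text \<open>The Lipschitz estimate against the zero tuple.\<close>

lemma trace_norm_lincomb_le_sum_entries:
  assumes "\<And>i. herm_mat m (A i)" "norm u = 1"
  shows "trace_norm (lincomb_mat m u A) \<le> (\<Sum>i\<in>UNIV. \<Sum>a<m. \<Sum>b<m. cmod (A i $$ (a, b)))"
proof -
  define Z where "Z = (\<lambda>i::'a. herm_part m (\<lambda>j k. 0))"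
  have Z: "herm_mat m (Z i)" "j < m \<Longrightarrow> k < m \<Longrightarrow> Z i $$ (j, k) = 0" for i j k
    by (simp_all add: Z_def herm_part_herm) (simp add: herm_part_def)
  have "trace_norm (lincomb_mat m u Z) = 0" using Z by (rule trace_norm_lincomb_zero)
  then show ?thesis using trace_norm_lincomb_diff_le[of m A Z u, OF assms(1) Z(1) assms(2)] Z(2) by simp
qed

lemma isCont_trace_norm_herm_curve:
  fixes u :: "real ^ 'd"
  assumes "norm u = 1"
  shows "isCont (\<lambda>t. trace_norm (lincomb_mat m u (herm_curve m c t))) x"
proof -
  let ?err = "\<lambda>t. \<Sum>i\<in>(UNIV :: 'd set). \<Sum>a<m. \<Sum>b<m. cmod (herm_curve m c t i $$ (a, b) - herm_curve m c x i $$ (a, b))"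
  have "((\<lambda>t. herm_curve m c t i $$ (a, b)) \<longlongrightarrow> herm_curve m c x i $$ (a, b)) (at x)"
    if "a < m" "b < m" for a b and i :: 'd
    using continuous_herm_curve[OF that, of c i] unfolding continuous_on_def by simp
  then have "(?err \<longlongrightarrow> (\<Sum>i\<in>(UNIV :: 'd set). \<Sum>a<m. \<Sum>b<m. cmod (herm_curve m c x i $$ (a, b) - herm_curve m c x i $$ (a, b)))) (at x)"
    by (intro tendsto_intros) auto
  then have "(?err \<longlongrightarrow> 0) (at x)" by simp
  then have "((\<lambda>t. trace_norm (lincomb_mat m u (herm_curve m c t)) - trace_norm (lincomb_mat m u (herm_curve m c x))) \<longlongrightarrow> 0) (at x)"
    by (rule Lim_null_comparison[rotated])
      (simp add: trace_norm_lincomb_diff_le[OF herm_curve_herm herm_curve_herm assms])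
  then show ?thesis unfolding isCont_def by (rule LIM_zero_cancel)
qed

lemma trace_norm_herm_curve_bounded:
  fixes u :: "real ^ 'd"
  assumes "norm u = 1"
  shows "\<bar>trace_norm (lincomb_mat m u (herm_curve m c t))\<bar> \<le> (\<Sum>i\<in>(UNIV :: 'd set). \<Sum>a<m. \<Sum>b<m. 4 * \<bar>c\<bar>)"
proof -
  have "trace_norm (lincomb_mat m u (herm_curve m c t))
      \<le> (\<Sum>i\<in>(UNIV :: 'd set). \<Sum>a<m. \<Sum>b<m. cmod (herm_curve m c t i $$ (a, b)))"
    by (rule trace_norm_lincomb_le_sum_entries[OF herm_curve_herm assms])
  also have "\<dots> \<le> (\<Sum>i\<in>(UNIV :: 'd set). \<Sum>a<m. \<Sum>b<m. 4 * \<bar>c\<bar>)"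
    by (intro sum_mono herm_curve_bounded) auto
  finally show ?thesis using trace_norm_nonneg[of "lincomb_mat m u (herm_curve m c t)"] by simp
qed

lemma frob_norm_square: "(frob_norm m A)\<^sup>2 = (\<Sum>j<m. \<Sum>k<m. (cmod (A $$ (j, k)))\<^sup>2)"
  unfolding frob_norm_def by (intro real_sqrt_pow2 sum_nonneg) auto

text \<open>Each tuple is split into its size and a rescaled tuple of entry size at most
  \<open>c\<close>: the size becomes a probability, and the rescaled tuple becomes a parameter of
  \<open>herm_curve m c\<close>. Weak convergence then applies to bounded continuous functions of
  that parameter.\<close>

lemma operanoid_imp_random_rep:
  fixes Z :: "(real ^ 'd) set"
  assumes Z: "convex_body Z" "uminus ` Z = Z" and "operanoid m Z"
  shows "\<exists>(M :: real measure) A. random_rep m Z M A"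
proof -
  let ?T = "\<lambda>u A. trace_norm (lincomb_mat m u A)"
  from assms(3) obtain Zs where Zs: "\<And>k. operatope m (Zs k)" "(\<lambda>k. hausdorff_dist (Zs k) Z) \<longlonglongrightarrow> 0"
    by (auto simp: operanoid_def)
  have "\<forall>k. \<exists>N v A. (\<forall>j<N. \<forall>i. herm_mat m (A j i)) \<and>
        (\<forall>u. supp_fun (Zs k) u = inner v u + (\<Sum>j<(N::nat). ?T u (A j)))"
    using Zs(1) unfolding operatope_def by meson
  then obtain N :: "nat \<Rightarrow> nat" and v and A :: "nat \<Rightarrow> nat \<Rightarrow> 'd \<Rightarrow> complex mat" where
    A: "\<And>k j i. j < N k \<Longrightarrow> herm_mat m (A k j i)" and
    supp: "\<And>k u. supp_fun (Zs k) u = inner (v k) u + (\<Sum>j<N k. ?T u (A k j))"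
    by metis
  define g where "g k u = (\<Sum>j<N k. ?T u (A k j))" for k u
  have supp_lim: "(\<lambda>k. supp_fun (Zs k) u) \<longlonglongrightarrow> supp_fun Z u" if u: "norm u = 1" for u
  proof -
    have "(\<lambda>k. supp_fun (Zs k) u - supp_fun Z u) \<longlonglongrightarrow> 0"
      by (rule Lim_null_comparison[OF _ Zs(2)])
        (use hausdorff_dist_upper[OF _ Z(1) u] Zs(1) in \<open>auto simp: operatope_def\<close>)
    then show ?thesis by (rule LIM_zero_cancel)
  qed
  have g_lim: "(\<lambda>k. g k u) \<longlonglongrightarrow> supp_fun Z u" if u: "norm u = 1" for u
  proof -
    \<comment> \<open>Averaging over \<open>u\<close> and \<open>- u\<close> removes the linear
      part, since the trace norms are even; the limit is unaffected because \<open>Z\<close> is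
      symmetric.\<close>
    have "g k u = (supp_fun (Zs k) u + supp_fun (Zs k) (- u)) / 2" for k
      unfolding supp g_def using A by (simp add: trace_norm_lincomb_minus)
    moreover have "(\<lambda>k. (supp_fun (Zs k) u + supp_fun (Zs k) (- u)) / 2)
        \<longlonglongrightarrow> (supp_fun Z u + supp_fun Z (- u)) / 2"
      using u by (intro tendsto_intros supp_lim) auto
    ultimately show ?thesis by (simp only: supp_fun_minus[OF Z(2)] field_sum_of_halves add_divide_distrib)
  qed
  define r where "r k j = (\<Sum>i\<in>UNIV. trace_norm (A k j i))" for k j
  have r_nonneg: "r k j \<ge> 0" for k j by (auto simp: r_def intro!: sum_nonneg trace_norm_nonneg)
  have r_sum: "(\<Sum>j<N k. r k j) = (\<Sum>i\<in>UNIV. g k (axis i 1))" for k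
    unfolding g_def r_def using A
    by (subst sum.swap) (simp add: trace_norm_lincomb_axis herm_mat_carrier)
  have "(\<lambda>k. \<Sum>i\<in>UNIV. g k (axis i 1)) \<longlonglongrightarrow> (\<Sum>i\<in>UNIV. supp_fun Z (axis i 1))"
    by (intro tendsto_sum g_lim) (simp add: norm_axis_1)
  then have "Bseq (\<lambda>k. \<Sum>i\<in>UNIV. g k (axis i 1))"
    by (intro convergent_imp_Bseq convergentI)
  \<comment> \<open>A convergent sequence is bounded, so one constant \<open>c\<close> bounds the
    total size of the tuples for every \<open>k\<close>. It serves both as normalisation of the mass
    and as entry bound for the curve.\<close>
  then obtain c where c: "c > 0" "\<And>k. norm (\<Sum>i\<in>UNIV. g k (axis i 1)) \<le> c"
    unfolding Bseq_def by blast
  have r_le: "(\<Sum>j<N k. r k j) \<le> c" for k using c(2)[of k] by (simp add: r_sum)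
  \<comment> \<open>The rescaled tuples. Index \<open>N k\<close> is given the zero tuple, and a
    tuple of size zero is itself zero, which agrees with division by zero yielding 0.\<close>
  define B where "B k j i = (if j < N k then Matrix.mat m m (\<lambda>(a, b). complex_of_real (c / r k j) * A k j i $$ (a, b))
     else herm_part m (\<lambda>a b. 0))" for k j i
  have entry_le_r: "cmod (A k j i $$ (a, b)) \<le> r k j" if "j < N k" "a < m" "b < m" for k j i a b
  proof -
    have "cmod (A k j i $$ (a, b)) \<le> trace_norm (A k j i)"
      by (rule entry_le_trace_norm[OF A[OF that(1)] that(2,3)])
    also have "\<dots> \<le> r k j" unfolding r_def by (intro member_le_sum) (auto simp: trace_norm_nonneg)
    finally show ?thesis .
  qed
  have B_herm: "herm_mat m (B k j i)" for k j i
  proof (cases "j < N k")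
    case True
    show ?thesis unfolding herm_mat_def
    proof (intro conjI allI impI)
      fix a b assume ab: "a < m" "b < m"
      have "A k j i $$ (b, a) = cnj (A k j i $$ (a, b))" using A[OF True] ab unfolding herm_mat_def by blast
      then show "B k j i $$ (b, a) = cnj (B k j i $$ (a, b))"
        using ab True by (simp add: B_def)
    qed (simp add: B_def True)
  qed (simp add: B_def herm_part_herm)
  have B_entry: "cmod (B k j i $$ (a, b)) \<le> c" if "a < m" "b < m" for k j i a b
  proof (cases "j < N k")
    case True
    have "c / r k j * cmod (A k j i $$ (a, b)) \<le> c / r k j * r k j"
      using c(1) r_nonneg by (intro mult_left_mono entry_le_r True that) auto
    also have "\<dots> \<le> c" using c(1) by simp
    finally show ?thesis using that True c(1) r_nonneg[of k j] by (simp add: B_def norm_mult norm_divide)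
  qed (use c that in \<open>simp add: B_def herm_part_def\<close>)
  have "\<forall>k j. \<exists>t. 0 \<le> t \<and> t \<le> 1 \<and> (\<forall>i. herm_curve m c t i = B k j i)"
    by (intro allI herm_curve_surj B_herm B_entry c(1))
  then obtain t where t: "\<And>k j. 0 \<le> t k j \<and> t k j \<le> 1" "\<And>k j i. herm_curve m c (t k j) i = B k j i"
    by metis
  \<comment> \<open>Weight \<open>r k j / c\<close> undoes the rescaling by
    \<open>c / r k j\<close>. The missing mass goes to index \<open>N k\<close>, where the zero
    tuple contributes nothing.\<close>
  define w where "w k j = (if j < N k then r k j / c else 1 - (\<Sum>j<N k. r k j) / c)" for k j
  have w: "w k j \<ge> 0" "(\<Sum>j<Suc (N k). w k j) = 1" for k j
    using c(1) r_nonneg r_le[of k] by (auto simp: w_def field_simps sum_divide_distrib[symmetric])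
  have w_sum: "(\<Sum>j<Suc (N k). w k j * ?T u (herm_curve m c (t k j))) = g k u" for k u
  proof -
    have "?T u (B k j) * (r k j / c) = ?T u (A k j)" if j: "j < N k" for j
    proof -
      have "?T u (A k j) = \<bar>r k j / c\<bar> * ?T u (B k j)"
      proof (rule trace_norm_lincomb_scale_mat)
        fix i a b assume ab: "a < m" "b < m"
        show "A k j i $$ (a, b) = complex_of_real (r k j / c) * B k j i $$ (a, b)"
          \<comment> \<open>If \<open>r k j = 0\<close>, the entries of \<open>A\<close> vanish by
            \<open>entry_le_r\<close>, so both sides are 0.\<close>
          using entry_le_r[OF j ab, of i] c(1) ab j by (cases "r k j = 0") (auto simp: B_def)
      qed (use A j B_herm in auto)
      then show ?thesis using c(1) r_nonneg[of k j] by simp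
    qed
    moreover have "?T u (B k (N k)) = 0"
      by (rule trace_norm_lincomb_zero[OF B_herm]) (simp add: B_def herm_part_def)
    moreover have "herm_curve m c (t k j) = B k j" for j using t(2) by blast
    ultimately show ?thesis by (simp add: w_def g_def mult.commute)
  qed
  obtain s \<nu> where s: "strict_mono s" "real_distribution \<nu>"
    and conv: "\<forall>(f :: real \<Rightarrow> real) B. (\<forall>x. isCont f x) \<longrightarrow> (\<forall>x. \<bar>f x\<bar> \<le> B) \<longrightarrow>
      (\<lambda>k. \<Sum>j<Suc (N (s k)). w (s k) j * f (t (s k) j)) \<longlonglongrightarrow> integral\<^sup>L \<nu> f"
    using discrete_weak_limit[of w "\<lambda>k. Suc (N k)" t, OF w t(1)]
    by (elim exE conjE) (rule that)
  interpret \<nu>: real_distribution \<nu> by (rule s)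
  have entry_meas: "(\<lambda>x. herm_curve m c x i $$ (a, b)) \<in> borel_measurable \<nu>" if "a < m" "b < m" for a b and i :: 'd
    using borel_measurable_continuous_onI[OF continuous_herm_curve[OF that, of c i]]
    by (simp cong: measurable_cong_sets)
  have "random_rep m Z \<nu> (herm_curve m c)"
    unfolding random_rep_def
  proof (intro conjI ballI allI impI)
    show "prob_space \<nu>" by (rule \<nu>.prob_space_axioms)
    show "herm_mat m (herm_curve m c x i)" for x i by (rule herm_curve_herm)
    show "(\<lambda>x. herm_curve m c x i $$ (a, b)) \<in> borel_measurable \<nu>" if "a < m" "b < m" for a b and i :: 'd
      by (rule entry_meas[OF that])
    show "integrable \<nu> (\<lambda>x. sqrt (\<Sum>i\<in>UNIV. (frob_norm m (herm_curve m c x (i :: 'd)))\<^sup>2))"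
    proof (rule \<nu>.integrable_const_bound)
      show "AE x in \<nu>. norm (sqrt (\<Sum>i\<in>UNIV. (frob_norm m (herm_curve m c x (i :: 'd)))\<^sup>2))
          \<le> sqrt (\<Sum>i\<in>(UNIV :: 'd set). \<Sum>a<m. \<Sum>b<m. (4 * \<bar>c\<bar>)\<^sup>2)"
      proof (intro AE_I2)
        fix x
        have "(\<Sum>i\<in>UNIV. (frob_norm m (herm_curve m c x (i :: 'd)))\<^sup>2)
            \<le> (\<Sum>i\<in>(UNIV :: 'd set). \<Sum>a<m. \<Sum>b<m. (4 * \<bar>c\<bar>)\<^sup>2)"
          unfolding frob_norm_square by (intro sum_mono power_mono herm_curve_bounded) auto
        moreover have "0 \<le> (\<Sum>i\<in>UNIV. (frob_norm m (herm_curve m c x (i :: 'd)))\<^sup>2)"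
          by (intro sum_nonneg) auto
        ultimately show "norm (sqrt (\<Sum>i\<in>UNIV. (frob_norm m (herm_curve m c x (i :: 'd)))\<^sup>2))
          \<le> sqrt (\<Sum>i\<in>(UNIV :: 'd set). \<Sum>a<m. \<Sum>b<m. (4 * \<bar>c\<bar>)\<^sup>2)"
          by (simp only: real_norm_def real_sqrt_abs real_sqrt_le_mono real_sqrt_ge_0_iff abs_of_nonneg)
      qed
      show "(\<lambda>x. sqrt (\<Sum>i\<in>UNIV. (frob_norm m (herm_curve m c x (i :: 'd)))\<^sup>2)) \<in> borel_measurable \<nu>"
        unfolding frob_norm_square
        by (intro measurable_compose[OF _ borel_measurable_sqrt] borel_measurable_sum borel_measurable_power
              measurable_compose[OF _ borel_measurable_norm] entry_meas) auto
    qed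
    fix u :: "real ^ 'd" assume "u \<in> sphere 0 1"
    then have u: "norm u = 1" by simp
    have "(\<lambda>k. g (s k) u) \<longlonglongrightarrow> (\<integral>x. ?T u (herm_curve m c x) \<partial>\<nu>)"
      using conv[rule_format, OF isCont_trace_norm_herm_curve[OF u] trace_norm_herm_curve_bounded[OF u], of m c]
      by (simp only: w_sum)
    moreover have "(\<lambda>k. g (s k) u) \<longlonglongrightarrow> supp_fun Z u"
      using LIMSEQ_subseq_LIMSEQ[OF g_lim[OF u] s(1)] by (simp add: o_def)
    ultimately show "supp_fun Z u = (\<integral>x. ?T u (herm_curve m c x) \<partial>\<nu>)"
      by (rule LIMSEQ_unique[rotated])
  qed
  then show ?thesis by blast
qed

section \<open>From random matrices to operanoids\<close>

text \<open>Coordinates are added one at a time by function update. The constant \<open>c\<close>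
  fills the positions outside \<open>I\<close>, so the whole family takes finitely many
  values.\<close>

lemma simple_function_finite_family:
  assumes "finite I" "\<And>i. i \<in> I \<Longrightarrow> simple_function M (f i)"
  shows "simple_function M (\<lambda>x i. if i \<in> I then f i x else c)"
  using assms
proof (induction I rule: finite_induct)
  case empty
  show ?case by simp
next
  case (insert p I)
  have "simple_function M (\<lambda>x. (\<lambda>i. if i \<in> I then f i x else c)(p := f p x))"
    using insert by (intro simple_function_compose2[of M _ _ "\<lambda>h y. h(p := y)"]) auto
  moreover have "(\<lambda>i. if i \<in> I then f i x else c)(p := f p x) = (\<lambda>i. if i \<in> insert p I then f i x else c)" for x
    by auto
  ultimately show ?case by simp
qed

text \<open>The space splits into the finitely many level sets of \<open>f\<close>, on each of which
  \<open>g (f x)\<close> is constant.\<close>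

lemma (in finite_measure) integral_compose_simple_function:
  fixes g :: "'b \<Rightarrow> real"
  assumes "simple_function M f"
  shows "(\<integral>x. g (f x) \<partial>M) = (\<Sum>y\<in>f ` space M. measure M (f -` {y} \<inter> space M) * g y)"
proof -
  have fin: "finite (f ` space M)" using assms by (rule simple_functionD)
  have sets: "f -` {y} \<inter> space M \<in> sets M" for y using assms by (rule simple_functionD)
  have "(\<integral>x. g (f x) \<partial>M) = (\<integral>x. (\<Sum>y\<in>f ` space M. indicator (f -` {y} \<inter> space M) x * g y) \<partial>M)"
  proof (rule Bochner_Integration.integral_cong[OF refl])
    fix x assume x: "x \<in> space M"
    have "(\<Sum>y\<in>f ` space M. indicator (f -` {y} \<inter> space M) x * g y) = (\<Sum>y\<in>f ` space M. if y = f x then g (f x) else 0)"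
      using x by (intro sum.cong) (auto simp: indicator_def)
    then show "g (f x) = (\<Sum>y\<in>f ` space M. indicator (f -` {y} \<inter> space M) x * g y)"
      using x fin by simp
  qed
  also have "\<dots> = (\<Sum>y\<in>f ` space M. (\<integral>x. indicator (f -` {y} \<inter> space M) x * g y \<partial>M))"
    using sets by (intro Bochner_Integration.integral_sum integrable_mult_left) (simp add: less_top[symmetric])
  also have "\<dots> = (\<Sum>y\<in>f ` space M. measure M (f -` {y} \<inter> space M) * g y)"
    using sets by (intro sum.cong refl) (simp add: Int_absorb2 sets.sets_into_space)
  finally show ?thesis .
qed

lemma hausdorff_dist_nonneg:
  fixes K L :: "(real ^ 'd) set"
  assumes "convex_body K" "convex_body L"
  shows "hausdorff_dist K L \<ge> 0"
  using hausdorff_dist_upper[OF assms norm_axis_1[of undefined]] by linarith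

text \<open>The sum of trace norms is sublinear and even, hence the support function of a symmetric
  body; the linear part is taken to be 0.\<close>

lemma operatope_exists:
  fixes A :: "nat \<Rightarrow> 'd::finite \<Rightarrow> complex mat"
  assumes N: "N \<ge> 1" and A: "\<And>j i. j < N \<Longrightarrow> herm_mat m (A j i)"
  shows "\<exists>K. operatope m K \<and> (\<forall>u. supp_fun K u = (\<Sum>j<N. trace_norm (lincomb_mat m u (A j))))"
proof -
  let ?h = "\<lambda>u. \<Sum>j<N. trace_norm (lincomb_mat m u (A j))"
  have "\<exists>K. convex_body K \<and> uminus ` K = K \<and> supp_fun K = ?h"
  proof (rule sublinear_is_supp_fun)
    show "?h (u + v) \<le> ?h u + ?h v" for u v
      unfolding sum.distrib[symmetric] using A by (intro sum_mono trace_norm_lincomb_add) auto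
    show "?h (c *\<^sub>R u) = c * ?h u" if "c > 0" for c u
      using A that by (simp add: trace_norm_lincomb_scale sum_distrib_left)
    show "?h (- u) = ?h u" for u
      using A by (simp add: trace_norm_lincomb_minus)
  qed
  then obtain K where K: "convex_body K" "uminus ` K = K" "supp_fun K = ?h" by blast
  then have "operatope m K"
    unfolding operatope_def using N A
    by (intro conjI centrally_symmetric_uminus exI[of _ N] exI[of _ 0] exI[of _ A]) auto
  then show ?thesis using K(3) by auto
qed

text \<open>A simple random tuple yields an operatope, and its Hausdorff distance to
  \<open>Z\<close> is at most the expected entrywise error, which tends to 0 by dominated
  convergence.\<close>

lemma random_rep_imp_operanoid:
  fixes Z :: "(real ^ 'd) set" and M :: "'w measure"
  assumes Z: "convex_body Z" "uminus ` Z = Z" and rep: "random_rep m Z M A"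
  shows "operanoid m Z"
proof -
  let ?T = "\<lambda>u A. trace_norm (lincomb_mat m u A)"
  have A_herm: "herm_mat m (A x i)" if "x \<in> space M" for x i
    using rep that by (auto simp: random_rep_def)
  have A_meas: "(\<lambda>x. A x i $$ (j, k)) \<in> borel_measurable M" if "j < m" "k < m" for i j k
    using rep that by (auto simp: random_rep_def)
  define R where "R x = sqrt (\<Sum>i\<in>UNIV. (frob_norm m (A x i))\<^sup>2)" for x
  have R_int: "integrable M R" using rep by (simp add: random_rep_def R_def[abs_def])
  have Z_supp: "supp_fun Z u = (\<integral>x. ?T u (A x) \<partial>M)" if "norm u = 1" for u
    using rep that by (auto simp: random_rep_def)
  interpret prob_space M using rep by (simp add: random_rep_def)
  have A_le: "cmod (A x i $$ (j, k)) \<le> R x" if "j < m" "k < m" for x i j k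
  proof -
    have "(cmod (A x i $$ (j, k)))\<^sup>2 \<le> (\<Sum>k<m. (cmod (A x i $$ (j, k)))\<^sup>2)"
      using that by (intro member_le_sum) auto
    also have "\<dots> \<le> (\<Sum>j<m. \<Sum>k<m. (cmod (A x i $$ (j, k)))\<^sup>2)"
      using that by (intro member_le_sum[of j _ "\<lambda>j. \<Sum>k<m. (cmod (A x i $$ (j, k)))\<^sup>2"]) (auto intro: sum_nonneg)
    also have "\<dots> = (frob_norm m (A x i))\<^sup>2" by (simp add: frob_norm_square)
    also have "\<dots> \<le> (\<Sum>i\<in>UNIV. (frob_norm m (A x i))\<^sup>2)"
      by (intro member_le_sum) auto
    finally show ?thesis unfolding R_def by (rule real_le_rsqrt)
  qed
  \<comment> \<open>Pointwise approximation of one entry by simple functions; the factor 2 in the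
    norm bound supplies the domination used later.\<close>
  let ?approx = "\<lambda>i j k F. (\<forall>n. simple_function M (F n)) \<and>
      (\<forall>x\<in>space M. (\<lambda>n. F n x) \<longlonglongrightarrow> A x i $$ (j, k)) \<and>
      (\<forall>n. \<forall>x\<in>space M. dist (F n x) 0 \<le> 2 * dist (A x i $$ (j, k)) 0)"
  define F where "F i j k = (SOME F. ?approx i j k F)" for i j k
  have approx: "?approx i j k (F i j k)" if "j < m" "k < m" for i j k
    unfolding F_def by (rule someI_ex[OF borel_measurable_implies_sequence_metric[OF A_meas[OF that]]])
  have F: "simple_function M (F i j k n)"
    "x \<in> space M \<Longrightarrow> (\<lambda>n. F i j k n x) \<longlonglongrightarrow> A x i $$ (j, k)"
    "x \<in> space M \<Longrightarrow> cmod (F i j k n x) \<le> 2 * cmod (A x i $$ (j, k))"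
    if "j < m" "k < m" for i j k n x
    using approx[OF that, of i] by simp_all
  \<comment> \<open>The entries are approximated independently, so Hermitian symmetry is restored by
    averaging; the limit is already Hermitian and is preserved.\<close>
  define H where "H n x i = herm_part m (\<lambda>j k. F i j k n x)" for n x i
  have H_herm: "herm_mat m (H n x i)" for n x i by (simp add: H_def herm_part_herm)
  have H_entry: "H n x i $$ (j, k) = (F i j k n x + cnj (F i k j n x)) / 2" if "j < m" "k < m" for n x i j k
    using that by (simp add: H_def herm_part_def)
  define I where "I = (UNIV :: 'd set) \<times> {..<m} \<times> {..<m}"
  have H_simple: "simple_function M (H n)" for n
  proof -
    have "simple_function M (\<lambda>x p. if p \<in> I then (case p of (i, j, k) \<Rightarrow> F i j k n) x else 0)"
      by (rule simple_function_finite_family) (auto simp: I_def F(1))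
    then have "simple_function M (\<lambda>x. (\<lambda>\<phi> i. herm_part m (\<lambda>j k. \<phi> (i, j, k)))
        (\<lambda>p. if p \<in> I then (case p of (i, j, k) \<Rightarrow> F i j k n) x else 0))"
      by (rule simple_function_compose1)
    moreover have "(\<lambda>x. (\<lambda>\<phi> i. herm_part m (\<lambda>j k. \<phi> (i, j, k)))
        (\<lambda>p. if p \<in> I then (case p of (i, j, k) \<Rightarrow> F i j k n) x else 0)) = H n"
      by (intro ext eq_matI) (auto simp: H_def herm_part_def I_def)
    ultimately show ?thesis by simp
  qed
  define err where "err n x = (\<Sum>i\<in>UNIV. \<Sum>a<m. \<Sum>b<m. cmod (H n x i $$ (a, b) - A x i $$ (a, b)))" for n x
  have err_meas: "err n \<in> borel_measurable M" for n
    unfolding err_def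
  proof (intro borel_measurable_sum measurable_compose[OF _ borel_measurable_norm] borel_measurable_diff A_meas)
    show "(\<lambda>x. H n x i $$ (a, b)) \<in> borel_measurable M" for i a b
      by (intro borel_measurable_simple_function simple_function_compose1[OF H_simple, of "\<lambda>h. h i $$ (a, b)"])
  qed auto
  have err_lim: "(\<lambda>n. err n x) \<longlonglongrightarrow> 0" if x: "x \<in> space M" for x
  proof -
    have "(\<lambda>n. H n x i $$ (a, b)) \<longlonglongrightarrow> A x i $$ (a, b)" if ab: "a < m" "b < m" for i a b
    proof -
      have "(\<lambda>n. (F i a b n x + cnj (F i b a n x)) / 2) \<longlonglongrightarrow> (A x i $$ (a, b) + cnj (A x i $$ (b, a))) / 2"
        by (intro tendsto_intros F(2) ab x) auto
      moreover have "A x i $$ (a, b) = cnj (A x i $$ (b, a))"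
        by (rule herm_mat_index[OF A_herm[OF x] ab])
      then have "(A x i $$ (a, b) + cnj (A x i $$ (b, a))) / 2 = A x i $$ (a, b)"
        by (rule subst[where P = "\<lambda>z. (A x i $$ (a, b) + z) / 2 = A x i $$ (a, b)"]) simp
      ultimately show ?thesis by (simp only: H_entry[OF ab])
    qed
    then have "(\<lambda>n. err n x) \<longlonglongrightarrow> (\<Sum>i\<in>(UNIV :: 'd set). \<Sum>a<m. \<Sum>b<m. cmod (A x i $$ (a, b) - A x i $$ (a, b)))"
      unfolding err_def by (intro tendsto_intros) auto
    then show ?thesis by simp
  qed
  \<comment> \<open>The factor 3 is 2 for the approximation plus 1 for the entry of \<open>A\<close>
    itself.\<close>
  define D where "D x = (\<Sum>i\<in>(UNIV :: 'd set). \<Sum>a<m. \<Sum>b<m. 3 * R x)" for x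
  have D_int: "integrable M D"
    unfolding D_def by (intro Bochner_Integration.integrable_sum integrable_mult_right R_int)
  have err_nonneg: "err n x \<ge> 0" for n x by (auto simp: err_def intro!: sum_nonneg)
  have err_le: "err n x \<le> D x" if x: "x \<in> space M" for n x
    unfolding err_def D_def
  proof (intro sum_mono)
    fix i a b assume "a \<in> {..<m}" "b \<in> {..<m}"
    then have ab: "a < m" "b < m" by auto
    have "cmod (H n x i $$ (a, b) - A x i $$ (a, b)) \<le> cmod (H n x i $$ (a, b)) + cmod (A x i $$ (a, b))"
      by (rule norm_triangle_ineq4)
    also have "cmod (H n x i $$ (a, b)) \<le> (cmod (F i a b n x) + cmod (F i b a n x)) / 2"
      using norm_triangle_ineq[of "F i a b n x" "cnj (F i b a n x)"] by (simp add: H_entry[OF ab] norm_divide)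
    also have "\<dots> \<le> (2 * R x + 2 * R x) / 2"
      using F(3)[OF ab x, of i n] F(3)[OF ab(2,1) x, of i n] A_le[OF ab, of x i] A_le[OF ab(2,1), of x i] by simp
    finally show "cmod (H n x i $$ (a, b) - A x i $$ (a, b)) \<le> 3 * R x"
      using A_le[OF ab, of x i] by simp
  qed
  have err_int: "integrable M (err n)" for n
    by (rule Bochner_Integration.integrable_bound[OF D_int err_meas])
      (use err_le err_nonneg in \<open>auto intro!: AE_I2 order.trans[OF _ abs_ge_self]\<close>)
  have "(\<lambda>n. integral\<^sup>L M (err n)) \<longlonglongrightarrow> integral\<^sup>L M (\<lambda>x. 0)"
    by (rule integral_dominated_convergence[OF _ err_meas D_int])
      (use err_le err_nonneg err_lim in \<open>auto intro!: AE_I2\<close>)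
  then have err_integral: "(\<lambda>n. integral\<^sup>L M (err n)) \<longlonglongrightarrow> 0" by simp
  have T_diff: "\<bar>?T u (H n x) - ?T u (A x)\<bar> \<le> err n x" if "norm u = 1" "x \<in> space M" for u n x
    unfolding err_def by (intro trace_norm_lincomb_diff_le H_herm A_herm that)
  have TH_meas: "(\<lambda>x. ?T u (H n x)) \<in> borel_measurable M" for u n
    by (intro borel_measurable_simple_function simple_function_compose1[OF H_simple])
  have TA_int: "integrable M (\<lambda>x. ?T u (A x))" if u: "norm u = 1" for u
  proof (rule Bochner_Integration.integrable_bound[OF D_int])
    \<comment> \<open>Measurability comes from the pointwise limit of simple functions, which avoids
      measurability of eigenvalues.\<close>
    show "(\<lambda>x. ?T u (A x)) \<in> borel_measurable M"
    proof (rule borel_measurable_LIMSEQ_real[OF _ TH_meas])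
      fix x assume x: "x \<in> space M"
      have "(\<lambda>n. ?T u (H n x) - ?T u (A x)) \<longlonglongrightarrow> 0"
        by (rule Lim_null_comparison[OF _ err_lim[OF x]]) (simp add: T_diff[OF u x])
      then show "(\<lambda>n. ?T u (H n x)) \<longlonglongrightarrow> ?T u (A x)" by (rule LIM_zero_cancel)
    qed
    have "\<bar>?T u (A x)\<bar> \<le> \<bar>D x\<bar>" if x: "x \<in> space M" for x
    proof -
      have "?T u (A x) \<le> (\<Sum>i\<in>UNIV. \<Sum>a<m. \<Sum>b<m. cmod (A x i $$ (a, b)))"
        by (intro trace_norm_lincomb_le_sum_entries A_herm x u)
      also have "\<dots> \<le> D x"
        unfolding D_def
      proof (intro sum_mono)
        fix i a b assume "a \<in> {..<m}" "b \<in> {..<m}"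
        then have "cmod (A x i $$ (a, b)) \<le> R x" by (intro A_le) auto
        then show "cmod (A x i $$ (a, b)) \<le> 3 * R x"
          using norm_ge_zero[of "A x i $$ (a, b)"] by linarith
      qed
      finally show ?thesis using trace_norm_nonneg[of "lincomb_mat m u (A x)"] by simp
    qed
    then show "AE x in M. norm (?T u (A x)) \<le> norm (D x)" by (intro AE_I2) simp
  qed
  have TH_int: "integrable M (\<lambda>x. ?T u (H n x))" if u: "norm u = 1" for u n
  proof (rule Bochner_Integration.integrable_bound[OF Bochner_Integration.integrable_add[OF TA_int[OF u] err_int[of n]] TH_meas])
    show "AE x in M. norm (?T u (H n x)) \<le> norm (?T u (A x) + err n x)"
      using T_diff[OF u, of _ n] by (intro AE_I2) (smt (verit) real_norm_def trace_norm_nonneg)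
  qed
  have "\<exists>K. operatope m K \<and> hausdorff_dist K Z \<le> integral\<^sup>L M (err n)" for n
  proof -
    let ?X = "H n ` space M"
    have fin: "finite ?X" using H_simple by (rule simple_functionD)
    then obtain e where e: "bij_betw e {0..<card ?X} ?X" using ex_bij_betw_nat_finite by blast
    define p where "p y = measure M (H n -` {y} \<inter> space M)" for y
    \<comment> \<open>By homogeneity the probability of each value is absorbed into the matrices,
      turning the expectation into a plain sum of trace norms.\<close>
    define B where "B j i = Matrix.mat m m (\<lambda>(a, b). complex_of_real (p (e j)) * e j i $$ (a, b))" for j i
    have e_herm: "herm_mat m (e j i)" if "j < card ?X" for j i
    proof -
      have "e j \<in> ?X" using bij_betwE[OF e] that by simp
      then obtain x where "e j = H n x" by blast
      then show ?thesis by (simp only: H_herm)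
    qed
    have B_herm: "herm_mat m (B j i)" if j: "j < card ?X" for j i
      unfolding herm_mat_def
    proof (intro conjI allI impI)
      fix a b assume ab: "a < m" "b < m"
      have "e j i $$ (b, a) = cnj (e j i $$ (a, b))" by (rule herm_mat_index[OF e_herm[OF j] ab(2,1)])
      then show "B j i $$ (b, a) = cnj (B j i $$ (a, b))" using ab by (simp add: B_def)
    qed (simp add: B_def)
    \<comment> \<open>A probability space is nonempty, so at least one value occurs, as the
      definition of an operatope demands.\<close>
    have "card ?X \<ge> 1" using fin not_empty by (simp add: Suc_le_eq card_gt_0_iff)
    from operatope_exists[of "card ?X" m B, OF this B_herm] obtain K where
      K: "operatope m K" "\<And>u. supp_fun K u = (\<Sum>j<card ?X. ?T u (B j))" by blast
    have K_supp: "supp_fun K u = (\<integral>x. ?T u (H n x) \<partial>M)" for u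
    proof -
      have "?T u (B j) = p (e j) * ?T u (e j)" if j: "j < card ?X" for j
        using trace_norm_lincomb_scale_mat[of m "e j" "B j" "p (e j)" u, OF e_herm[OF j] B_herm[OF j]]
        by (simp add: B_def p_def)
      then have "supp_fun K u = (\<Sum>j\<in>{0..<card ?X}. p (e j) * ?T u (e j))"
        by (simp add: K(2) atLeast0LessThan)
      also have "\<dots> = (\<Sum>y\<in>?X. p y * ?T u y)" by (rule sum.reindex_bij_betw[OF e])
      also have "\<dots> = (\<integral>x. ?T u (H n x) \<partial>M)"
        using integral_compose_simple_function[OF H_simple, of "?T u" n] by (simp add: p_def)
      finally show ?thesis .
    qed
    have "hausdorff_dist K Z \<le> integral\<^sup>L M (err n)"
    proof (rule hausdorff_dist_le)
      fix u :: "real ^ 'd" assume u: "norm u = 1"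
      have "supp_fun K u - supp_fun Z u = (\<integral>x. ?T u (H n x) - ?T u (A x) \<partial>M)"
        unfolding K_supp Z_supp[OF u] using TH_int[OF u] TA_int[OF u] by simp
      also have "\<bar>\<dots>\<bar> \<le> (\<integral>x. \<bar>?T u (H n x) - ?T u (A x)\<bar> \<partial>M)"
        by (rule integral_abs_bound)
      also have "\<dots> \<le> integral\<^sup>L M (err n)"
        using TH_int[OF u] TA_int[OF u] err_int T_diff[OF u] by (intro integral_mono) auto
      finally show "\<bar>supp_fun K u - supp_fun Z u\<bar> \<le> integral\<^sup>L M (err n)" .
    qed
    with K(1) show ?thesis by blast
  qed
  then obtain Ks where Ks: "\<And>n. operatope m (Ks n)" "\<And>n. hausdorff_dist (Ks n) Z \<le> integral\<^sup>L M (err n)"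
    by metis
  have "(\<lambda>n. hausdorff_dist (Ks n) Z) \<longlonglongrightarrow> 0"
  proof (rule tendsto_sandwich[OF _ _ tendsto_const err_integral])
    show "eventually (\<lambda>n. 0 \<le> hausdorff_dist (Ks n) Z) sequentially"
      using Ks(1) Z(1) by (intro always_eventually allI hausdorff_dist_nonneg) (auto simp: operatope_def)
  qed (use Ks(2) in simp)
  then show ?thesis
    unfolding operanoid_def using Z Ks(1) centrally_symmetric_uminus by blast
qed

text \<open>Existence of a probability space quantifies over types, so the equivalence is split: the
  forward direction yields a measure on the real line, and the converse accepts a sample space of
  arbitrary type.\<close>

theorem mainTheorem1:
  fixes Z :: "(real^'d) set" and m :: nat
  assumes "convex_body Z" and "uminus ` Z = Z" and "m \<ge> 1"
  shows "(operanoid m Z \<longrightarrow> (\<exists>(M :: real measure) A. random_rep m Z M A))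
       \<and> ((\<exists>(M :: 'w measure) A. random_rep m Z M A) \<longrightarrow> operanoid m Z)"
  using operanoid_imp_random_rep[OF assms(1,2)] random_rep_imp_operanoid[OF assms(1,2)] by blast

end
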